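(* Let $n\ge1$, $V\in C^\infty(\mathbb T^n;\mathbb R^n)$ be divergence free with mean zero, and $p\in\mathbb R^n$. Let $$c_p=\inf_{\phi\in C^1(\mathbb T^n)}\max_{\mathbb T^n}\{V(x)\cdot(p+D\phi)\}.$$ Then $$c_p=\max_{\sigma\in\Lambda}\int_{\mathbb T^n}p\cdot V(x)\,d\sigma,$$ where $\Lambda$ is the collection of all Borel probability measures on $\mathbb T^n$ invariant under the flow $\dot\xi=V(\xi)$.
   Context: $\mathbb T^n=\mathbb R^n/\mathbb Z^n$ is the flat torus; functions on it are identified with $\mathbb Z^n$-periodic functions on $\mathbb R^n$. $D$ denotes the spatial gradient. *)

theory Defs
  imports "HOL-Probability.Probability"
begin

definition lattice_equiv :: "real ^ 'n \<Rightarrow> real ^ 'n \<Rightarrow> bool" where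
  "lattice_equiv x y \<longleftrightarrow> (\<forall>i. x $ i - y $ i \<in> \<int>)"

lemma equivp_lattice_equiv: "equivp (lattice_equiv :: real ^ 'n \<Rightarrow> real ^ 'n \<Rightarrow> bool)"
proof (rule equivpI)
  show "reflp (lattice_equiv :: real ^ 'n \<Rightarrow> real ^ 'n \<Rightarrow> bool)"
    by (simp add: reflp_def lattice_equiv_def)
  show "symp (lattice_equiv :: real ^ 'n \<Rightarrow> real ^ 'n \<Rightarrow> bool)"
  proof (rule sympI)
    fix x y :: "real ^ 'n"
    assume "lattice_equiv x y"
    then have "- (x $ i - y $ i) \<in> \<int>" for i
      unfolding lattice_equiv_def by (intro Ints_minus) auto
    then show "lattice_equiv y x"
      by (simp add: lattice_equiv_def)
  qed
  show "transp (lattice_equiv :: real ^ 'n \<Rightarrow> real ^ 'n \<Rightarrow> bool)"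
  proof (rule transpI)
    fix x y z :: "real ^ 'n"
    assume "lattice_equiv x y" "lattice_equiv y z"
    then have "(x $ i - y $ i) + (y $ i - z $ i) \<in> \<int>" for i
      unfolding lattice_equiv_def by (intro Ints_add) auto
    then show "lattice_equiv x z"
      by (simp add: lattice_equiv_def)
  qed
qed

quotient_type 'n torus = "real ^ 'n" / lattice_equiv
  by (rule equivp_lattice_equiv)

definition torus_proj :: "real ^ 'n \<Rightarrow> 'n torus" where
  "torus_proj = abs_torus"

text \<open>The quotient topology; it determines the Borel sigma-algebra \<^term>\<open>borel\<close> on the torus.\<close>

instantiation torus :: (finite) topological_space
begin

definition open_torus :: "'a torus set \<Rightarrow> bool" where
  "open_torus U \<longleftrightarrow> open (torus_proj -` U)"

instance
proof
  show "open (UNIV :: 'a torus set)"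
    by (simp add: open_torus_def)
  show "open (S \<inter> T)" if "open S" "open T" for S T :: "'a torus set"
    using that by (simp add: open_torus_def vimage_Int open_Int)
  show "open (\<Union> K)" if "\<forall>S\<in>K. open S" for K :: "'a torus set set"
    using that by (auto simp: open_torus_def vimage_Union intro: open_UN)
qed

end

text \<open>The periodic function on the covering space identified with a function on the torus.\<close>

definition periodic_lift :: "('n::finite torus \<Rightarrow> 'b) \<Rightarrow> real ^ 'n \<Rightarrow> 'b" where
  "periodic_lift f = f \<circ> torus_proj"

primrec k_times_cont_diff ::
    "nat \<Rightarrow> ('a::euclidean_space \<Rightarrow> 'b::real_normed_vector) \<Rightarrow> bool" where
  "k_times_cont_diff 0 f \<longleftrightarrow> continuous_on UNIV f"
| "k_times_cont_diff (Suc k) f \<longleftrightarrow>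
     f differentiable_on UNIV \<and>
     (\<forall>h. k_times_cont_diff k (\<lambda>x. frechet_derivative f (at x) h))"

definition torus_Ck :: "nat \<Rightarrow> ('n::finite torus \<Rightarrow> 'b::real_normed_vector) set" where
  "torus_Ck k = {f. k_times_cont_diff k (periodic_lift f)}"

definition torus_smooth :: "('n::finite torus \<Rightarrow> 'b::real_normed_vector) set" where
  "torus_smooth = (\<Inter>k. torus_Ck k)"

definition gradient :: "(real ^ 'n \<Rightarrow> real) \<Rightarrow> real ^ 'n \<Rightarrow> real ^ 'n" where
  "gradient f x = (\<chi> i. frechet_derivative f (at x) (axis i 1))"

definition divergence :: "(real ^ 'n \<Rightarrow> real ^ 'n) \<Rightarrow> real ^ 'n \<Rightarrow> real" where
  "divergence F x = trace (jacobian F (at x))"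

definition divergence_free :: "('n::finite torus \<Rightarrow> real ^ 'n) \<Rightarrow> bool" where
  "divergence_free V \<longleftrightarrow> (\<forall>x. divergence (periodic_lift V) x = 0)"

text \<open>The torus integral is computed over the fundamental cube from the origin to the all-ones vector.\<close>

definition mean_zero :: "('n::finite torus \<Rightarrow> real ^ 'n) \<Rightarrow> bool" where
  "mean_zero V \<longleftrightarrow> (LINT x:cbox 0 1|lborel. periodic_lift V x) = 0"

text \<open>The supremum is attained whenever \<open>V\<close> is continuous and \<open>\<phi>\<close> is \<open>C\<^sup>1\<close>, since the
  function is then continuous and periodic.  If \<open>V\<close> is moreover divergence free with mean zero,
  the integral of that function over a period vanishes, so all these maxima are at least 0 and
  the infimum is one of a nonempty set bounded below.\<close>

definition cell_value :: "('n::finite torus \<Rightarrow> real ^ 'n) \<Rightarrow> real ^ 'n \<Rightarrow> real" where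
  "cell_value V p =
     (INF \<phi>\<in>torus_Ck 1. SUP x. periodic_lift V x \<bullet> (p + gradient (periodic_lift \<phi>) x))"

text \<open>A curve on the torus is differentiated through a lift to the covering space.\<close>

definition integral_curve :: "('n::finite torus \<Rightarrow> real ^ 'n) \<Rightarrow> (real \<Rightarrow> 'n torus) \<Rightarrow> bool" where
  "integral_curve V \<xi> \<longleftrightarrow>
     (\<exists>\<eta>. \<xi> = torus_proj \<circ> \<eta> \<and> (\<forall>t. (\<eta> has_vector_derivative V (\<xi> t)) (at t)))"

text \<open>For \<open>V\<close> of class \<open>C\<^sup>1\<close> there is exactly one global integral curve through each point.\<close>

definition flow :: "('n::finite torus \<Rightarrow> real ^ 'n) \<Rightarrow> real \<Rightarrow> 'n torus \<Rightarrow> 'n torus" where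
  "flow V t z = (THE \<xi>. integral_curve V \<xi> \<and> \<xi> 0 = z) t"

definition invariant_measures :: "('n::finite torus \<Rightarrow> real ^ 'n) \<Rightarrow> 'n torus measure set" where
  "invariant_measures V =
     {\<sigma>. prob_space \<sigma> \<and> sets \<sigma> = sets borel \<and> (\<forall>t. distr \<sigma> borel (flow V t) = \<sigma>)}"

end

theory Submission
  imports Defs
begin

text \<open>
  No invariant \<open>\<sigma>\<close> exceeds the cell value because \<open>\<integral> V \<bullet> D\<phi> d\<sigma> = 0\<close>, the integrand being the
  derivative of \<open>\<phi>\<close> along the flow.  For the converse, write \<open>f = p \<bullet> V\<close>.  If \<open>\<phi>\<close> is the average of \<open>f\<close> along orbits
  of length \<open>T\<close> with weight \<open>T - s\<close>, then \<open>f + V \<bullet> D\<phi>\<close> is the plain average of \<open>f\<close> over these orbits, so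
  some orbit of length \<open>T\<close> has average at least the cell value.  A weak limit of the uniform measures
  on such orbits as \<open>T\<close> tends to infinity is invariant and attains the maximum.  Flow orbits are
  replaced by orbits of the Euler map \<open>x + h V(x)\<close>: its iterates are differentiable with bounds
  uniform in \<open>h\<close>, which avoids differentiability of the flow in the initial point, and they
  converge to the flow.
\<close>

section \<open>Flows of bounded Lipschitz fields\<close>

text \<open>The cell integrand contains the derivative of \<open>\<phi>\<close>, whereas along Euler
  orbits only the increment of \<open>\<phi>\<close> over one step has a closed form. The two differ
  by a Taylor remainder, of order h^2 for the increment and of order h after division by h. This is
  why Lipschitz constants of derivatives (\<open>C11\<close>) are carried through the iteration. For
  N steps with N h = T the resulting constants are bounded in h, but the bounds grow exponentially
  with T. Hence the order of choices: T first, then N so large that both the step T / N and the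
  error are small, and only then T to infinity. The two limits do different work: h to 0 turns
  iterates of the Euler map into the flow, while T to infinity gives invariance, because moving an
  orbit segment of length T by a time t exchanges only a share of order t / T of it.\<close>

lemma antiderivative_exists:
  fixes w :: "real \<Rightarrow> 'a::euclidean_space"
  assumes "continuous_on UNIV w"
  shows "\<exists>G. G 0 = 0 \<and> (\<forall>t. (G has_vector_derivative w t) (at t))"
proof -
  \<comment> \<open>Infinite endpoints give one antiderivative for both signs of t.\<close>
  have "\<exists>F. \<forall>x::real. (-\<infinity>::ereal) < x \<longrightarrow> x < (\<infinity>::ereal) \<longrightarrow> (F has_vector_derivative w x) (at x)"
    using assms by (intro einterval_antiderivative) (auto simp: continuous_on_eq_continuous_at)
  then obtain F where F: "\<And>x. (F has_vector_derivative w x) (at x)"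
    by auto
  have "((\<lambda>t. F t - F 0) has_vector_derivative w t) (at t)" for t
    using has_vector_derivative_diff[OF F[of t] has_vector_derivative_const[of "F 0"]] by simp
  then show ?thesis
    by (intro exI[of _ "\<lambda>t. F t - F 0"]) simp
qed

text \<open>Mean value inequality with a variable majorant: the Picard operator is estimated against
  the antiderivative of a weight, not against a constant. The absolute value on the right covers
  both orders of \<open>s\<close> and \<open>t\<close>.\<close>

lemma norm_increment_le:
  fixes G :: "real \<Rightarrow> 'a::real_normed_vector"
  assumes G: "\<And>s. (G has_vector_derivative g s) (at s)"
    and P: "\<And>s. (P has_real_derivative q s) (at s)"
    and le: "\<And>s. norm (g s) \<le> q s"
  shows "norm (G t - G s) \<le> \<bar>P t - P s\<bar>"
proof -
  have contG: "continuous_on A G" for A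
    by (meson G continuous_at_imp_continuous_on has_vector_derivative_continuous)
  have contP: "continuous_on A P" for A
    by (meson P DERIV_isCont continuous_at_imp_continuous_on)
  have "norm (G b - G a) \<le> P b - P a" if "a < b" for a b
    by (rule differentiable_bound_general[OF that contG contP, of g q])
      (use G P le in \<open>auto simp: has_real_derivative_iff_has_vector_derivative\<close>)
  from this[of s t] this[of t s] show ?thesis
    by (cases s t rule: linorder_cases) (auto simp: norm_minus_commute)
qed

text \<open>\<open>L\<close> is strictly positive because the global Picard argument divides by
  \<open>2 * L\<close>. The bound \<open>M\<close> keeps displacements at most linear in
  time.\<close>

locale bounded_lipschitz_field =
  fixes F :: "'a::euclidean_space \<Rightarrow> 'a" and L M :: real
  assumes L_pos: "0 < L"
    and F_lipschitz: "norm (F x - F y) \<le> L * norm (x - y)"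
    and F_bounded: "norm (F x) \<le> M"
begin

definition solution :: "(real \<Rightarrow> 'a) \<Rightarrow> bool" where
  "solution u \<longleftrightarrow> (\<forall>t. (u has_vector_derivative F (u t)) (at t))"

lemma M_nonneg: "0 \<le> M"
  using F_bounded norm_ge_zero order_trans by blast

lemma F_continuous: "continuous_on S F"
proof (rule continuous_on_subset)
  have "L-lipschitz_on UNIV F"
    using L_pos F_lipschitz by (auto simp: lipschitz_on_def dist_norm)
  then show "continuous_on UNIV F"
    by (rule lipschitz_on_continuous_on)
qed simp

text \<open>Gronwall's argument for the squared distance, which remains differentiable where the two
  solutions meet. The factor \<open>exp (-2 * L * t)\<close> makes it nonincreasing for positive
  times, \<open>exp (2 * L * t)\<close> nondecreasing for negative ones.\<close>

lemma solution_gronwall: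
  assumes u: "solution u" and v: "solution v"
  shows "norm (u t - v t) \<le> exp (L * \<bar>t\<bar>) * norm (u 0 - v 0)"
proof -
  define d where "d t = (u t - v t) \<bullet> (u t - v t)" for t
  define d' where "d' t = 2 * ((u t - v t) \<bullet> (F (u t) - F (v t)))" for t
  have e: "((\<lambda>t. u t - v t) has_vector_derivative F (u t) - F (v t)) (at t)" for t
    using u v by (intro has_vector_derivative_diff) (auto simp: solution_def)
  have d: "(d has_real_derivative d' t) (at t)" for t
    using has_derivative_inner[OF e[of t, unfolded has_vector_derivative_def] e[of t, unfolded has_vector_derivative_def]]
    unfolding d_def[abs_def] d'_def has_field_derivative_def
    by (rule has_derivative_eq_rhs) (simp add: fun_eq_iff inner_commute)
  have d'_le: "\<bar>d' t\<bar> \<le> 2 * L * d t" for t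
  proof -
    have "\<bar>d' t\<bar> \<le> 2 * (norm (u t - v t) * norm (F (u t) - F (v t)))"
      using Cauchy_Schwarz_ineq2[of "u t - v t" "F (u t) - F (v t)"] by (simp add: d'_def abs_mult)
    also have "\<dots> \<le> 2 * (norm (u t - v t) * (L * norm (u t - v t)))"
      by (intro mult_left_mono F_lipschitz) auto
    finally show ?thesis
      by (simp add: d_def dot_square_norm power2_eq_square mult_ac)
  qed
  have "d t \<le> exp (2 * L * \<bar>t\<bar>) * d 0"
  proof (cases "t \<ge> 0")
    case True
    have "d t * exp (-2 * L * t) \<le> d 0 * exp (-2 * L * 0)"
    proof (rule DERIV_nonpos_imp_nonincreasing[OF True])
      fix s
      have "((\<lambda>s. d s * exp (-2 * L * s)) has_real_derivative (d' s - 2 * L * d s) * exp (-2 * L * s)) (at s)"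
        by (auto intro!: derivative_eq_intros d simp: algebra_simps)
      moreover have "(d' s - 2 * L * d s) * exp (-2 * L * s) \<le> 0"
        using d'_le[of s] by (simp add: mult_le_0_iff abs_le_iff)
      ultimately show "\<exists>y. ((\<lambda>s. d s * exp (-2 * L * s)) has_real_derivative y) (at s) \<and> y \<le> 0"
        by blast
    qed
    then show ?thesis
      using True by (simp add: exp_minus field_simps)
  next
    case False
    have "d t * exp (2 * L * t) \<le> d 0 * exp (2 * L * 0)"
    proof (rule DERIV_nonneg_imp_nondecreasing[of t 0 "\<lambda>s. d s * exp (2 * L * s)"])
      show "t \<le> 0" using False by simp
      fix s
      have "((\<lambda>s. d s * exp (2 * L * s)) has_real_derivative (d' s + 2 * L * d s) * exp (2 * L * s)) (at s)"
        by (auto intro!: derivative_eq_intros d simp: algebra_simps)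
      moreover have "(d' s + 2 * L * d s) * exp (2 * L * s) \<ge> 0"
        using d'_le[of s] by (simp add: abs_le_iff)
      ultimately show "\<exists>y. ((\<lambda>s. d s * exp (2 * L * s)) has_real_derivative y) (at s) \<and> y \<ge> 0"
        by blast
    qed
    then show ?thesis
      using False by (simp add: exp_minus field_simps)
  qed
  then have "(norm (u t - v t))\<^sup>2 \<le> (exp (L * \<bar>t\<bar>) * norm (u 0 - v 0))\<^sup>2"
    by (simp add: d_def dot_square_norm power_mult_distrib mult_ac flip: exp_double)
  then show ?thesis
    by (rule power2_le_imp_le) simp
qed

lemma solution_unique: "solution u \<Longrightarrow> solution v \<Longrightarrow> u 0 = v 0 \<Longrightarrow> u = v"
  using solution_gronwall[of u v] by (auto simp: fun_eq_iff)

text \<open>In the weight \<open>W t = exp (2 L t) + exp (- 2 L t)\<close> the Picard operator contracts on the whole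
  line, so no local solutions have to be glued together.\<close>

lemma solution_exists: "\<exists>u. solution u \<and> u 0 = x"
proof -
  define W where "W t = exp (2 * L * t) + exp (- 2 * L * t)" for t
  define P where "P t = (exp (2 * L * t) - exp (- 2 * L * t)) / (2 * L)" for t
  have W_pos: "0 < W t" for t by (simp add: W_def add_pos_pos)
  have P: "(P has_real_derivative W t) (at t)" for t
    unfolding P_def W_def using L_pos
    by (auto intro!: derivative_eq_intros simp: field_simps)
  \<comment> \<open>An exponent \<lambda> in \<open>W\<close> yields an antiderivative of size at
    most \<open>W\<close> / \<lambda>; with \<lambda> = 2 L the Lipschitz constant L becomes the
    contraction factor 1/2.\<close>
  have P_le: "L * \<bar>P t\<bar> \<le> W t / 2" for t
  proof -
    have "\<bar>exp (2 * L * t) - exp (- 2 * L * t)\<bar> \<le> W t"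
      using exp_gt_zero[of "2 * L * t"] exp_gt_zero[of "- 2 * L * t"] unfolding W_def by linarith
    then show ?thesis using L_pos by (simp add: P_def abs_divide)
  qed
  have W_ge: "2 * L * \<bar>t\<bar> \<le> W t" for t
  proof -
    have "2 * L * t \<le> W t" "- (2 * L * t) \<le> W t"
      using exp_ge_add_one_self[of "2 * L * t"] exp_ge_add_one_self[of "- 2 * L * t"]
        exp_gt_zero[of "2 * L * t"] exp_gt_zero[of "- 2 * L * t"] unfolding W_def by linarith+
    then show ?thesis by (cases "t \<ge> 0") auto
  qed
  have W_cont: "continuous_on S W" for S
    unfolding W_def by (intro continuous_intros)
  \<comment> \<open>The unknown is the rescaled displacement v = (u - x) / W. It is bounded, since u
    - x grows at most linearly and \<open>W\<close> dominates \<open>2 * L * \<bar>t\<bar>\<close>,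
    so the fixed point is sought in the complete space of bounded continuous functions.\<close>
  define rhs where "rhs v s = F (x + W s *\<^sub>R apply_bcontfun v s)" for v s
  have "\<exists>G. G 0 = 0 \<and> (\<forall>t. (G has_vector_derivative rhs v t) (at t))" for v
    unfolding rhs_def
    by (intro antiderivative_exists continuous_intros continuous_on_compose2[OF F_continuous[of UNIV]] W_cont) auto
  then obtain G where G0: "\<And>v. G v 0 = 0" and G: "\<And>v t. (G v has_vector_derivative rhs v t) (at t)"
    by metis
  define T where "T v = Bcontfun (\<lambda>t. G v t /\<^sub>R W t)" for v
  have T_apply: "apply_bcontfun (T v) t = G v t /\<^sub>R W t" for v t
  proof -
    have "continuous_on UNIV (G v)"
      by (meson G continuous_at_imp_continuous_on has_vector_derivative_continuous)
    moreover have "norm (G v t /\<^sub>R W t) \<le> M / (2 * L)" for t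
    proof -
      have "norm (G v t - G v 0) \<le> \<bar>M * t - M * 0\<bar>"
        by (rule norm_increment_le[OF G, where q="\<lambda>_. M"])
          (auto intro!: derivative_eq_intros F_bounded simp: rhs_def)
      then have "norm (G v t) \<le> M * \<bar>t\<bar>"
        using M_nonneg by (simp add: G0 abs_mult)
      also have "\<dots> \<le> M * (W t / (2 * L))"
        using W_ge[of t] L_pos M_nonneg by (intro mult_left_mono) (auto simp: field_simps)
      finally show ?thesis
        using W_pos[of t] L_pos by (simp add: field_simps)
    qed
    ultimately have "(\<lambda>t. G v t /\<^sub>R W t) \<in> bcontfun"
      using W_pos by (intro bcontfun_normI[where b="M / (2 * L)"] continuous_intros W_cont)
        (auto simp: less_imp_neq[THEN not_sym])
    then show ?thesis
      unfolding T_def by (simp add: Bcontfun_inverse)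
  qed
  have "dist (T v) (T w) \<le> (1 / 2) * dist v w" for v w
  proof (rule dist_bound)
    fix t
    have "norm (rhs v s - rhs w s) \<le> (L * dist v w) * W s" for s
    proof -
      have "norm (rhs v s - rhs w s) \<le> L * norm (W s *\<^sub>R (apply_bcontfun v s - apply_bcontfun w s))"
        using F_lipschitz[of "x + W s *\<^sub>R apply_bcontfun v s" "x + W s *\<^sub>R apply_bcontfun w s"]
        by (simp add: rhs_def scaleR_diff_right)
      also have "\<dots> = L * (W s * dist (apply_bcontfun v s) (apply_bcontfun w s))"
        using W_pos[of s] by (simp add: dist_norm)
      also have "\<dots> \<le> L * (W s * dist v w)"
        using W_pos[of s] L_pos by (intro mult_left_mono dist_bounded) auto
      finally show ?thesis by (simp add: mult_ac)
    qed
    moreover have "((\<lambda>t. (L * dist v w) * P t) has_real_derivative (L * dist v w) * W s) (at s)" for s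
      by (intro DERIV_cmult P)
    moreover have "((\<lambda>t. G v t - G w t) has_vector_derivative rhs v s - rhs w s) (at s)" for s
      by (intro has_vector_derivative_diff G)
    ultimately have "norm ((G v t - G w t) - (G v 0 - G w 0)) \<le> \<bar>(L * dist v w) * P t - (L * dist v w) * P 0\<bar>"
      by (intro norm_increment_le)
    then have "norm (G v t - G w t) \<le> dist v w * (L * \<bar>P t\<bar>)"
      using L_pos by (simp add: G0 P_def[of 0] abs_mult mult_ac)
    also have "\<dots> \<le> dist v w * (W t / 2)"
      by (intro mult_left_mono P_le) auto
    finally have "norm (G v t - G w t) / W t \<le> 1 / 2 * dist v w"
      using W_pos[of t] by (simp add: field_simps)
    moreover have "apply_bcontfun (T v) t - apply_bcontfun (T w) t = inverse (W t) *\<^sub>R (G v t - G w t)"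
      by (simp add: T_apply scaleR_diff_right)
    moreover have "norm (inverse (W t) *\<^sub>R z) = norm z / W t" for z :: 'a
      using W_pos[of t] by (simp add: field_simps)
    ultimately show "dist (apply_bcontfun (T v) t) (apply_bcontfun (T w) t) \<le> 1 / 2 * dist v w"
      by (simp only: dist_norm)
  qed
  then obtain v where "T v = v"
    using banach_fix_type[of "1 / 2" T] by auto
  then have v: "W t *\<^sub>R apply_bcontfun v t = G v t" for t
    using T_apply[of v t] W_pos[of t] by simp
  have "solution (\<lambda>t. x + G v t)"
    unfolding solution_def using G[of v] by (auto simp: rhs_def v intro!: derivative_eq_intros)
  then show ?thesis
    using G0 by (intro exI[of _ "\<lambda>t. x + G v t"]) auto
qed

definition trajectory :: "'a \<Rightarrow> real \<Rightarrow> 'a" where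
  "trajectory x = (SOME u. solution u \<and> u 0 = x)"

lemma trajectory_solution: "solution (trajectory x)"
  and trajectory_0 [simp]: "trajectory x 0 = x"
  using someI_ex[OF solution_exists[of x]] by (auto simp: trajectory_def)

lemma trajectory_deriv: "(trajectory x has_vector_derivative F (trajectory x t)) (at t)"
  using trajectory_solution by (auto simp: solution_def)

lemma trajectory_unique: "solution u \<Longrightarrow> u = trajectory (u 0)"
  by (intro solution_unique trajectory_solution) auto

lemma trajectory_lipschitz: "norm (trajectory x t - trajectory y t) \<le> exp (L * \<bar>t\<bar>) * norm (x - y)"
  using solution_gronwall[OF trajectory_solution trajectory_solution, of x t y] by simp

lemma trajectory_continuous: "continuous_on S (\<lambda>x. trajectory x t)"
proof (rule continuous_on_subset)
  have "(exp (L * \<bar>t\<bar>))-lipschitz_on UNIV (\<lambda>x. trajectory x t)"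
    using trajectory_lipschitz by (auto simp: lipschitz_on_def dist_norm)
  then show "continuous_on UNIV (\<lambda>x. trajectory x t)"
    by (rule lipschitz_on_continuous_on)
qed simp

lemma trajectory_add: "trajectory x (s + t) = trajectory (trajectory x s) t"
proof -
  have "solution (\<lambda>t. trajectory x (s + t))"
    unfolding solution_def
  proof
    fix t
    have "(trajectory x \<circ> (\<lambda>t. s + t) has_vector_derivative 1 *\<^sub>R F (trajectory x (s + t))) (at t)"
      by (rule vector_diff_chain_at) (auto intro!: derivative_eq_intros trajectory_deriv)
    then show "((\<lambda>t. trajectory x (s + t)) has_vector_derivative F (trajectory x (s + t))) (at t)"
      by (simp add: o_def)
  qed
  from trajectory_unique[OF this] show ?thesis
    by (simp add: fun_eq_iff)
qed

lemma trajectory_minus: "trajectory (trajectory x t) (- t) = x"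
  using trajectory_add[of x t "- t"] by simp

lemma trajectory_speed: "norm (trajectory x t - trajectory x s) \<le> M * \<bar>t - s\<bar>"
proof -
  have "norm (trajectory x t - trajectory x s) \<le> \<bar>M * t - M * s\<bar>"
    by (rule norm_increment_le[OF trajectory_deriv, where q="\<lambda>_. M"])
      (auto intro!: derivative_eq_intros F_bounded)
  also have "\<dots> = M * \<bar>t - s\<bar>"
    using M_nonneg by (simp add: abs_mult flip: right_diff_distrib)
  finally show ?thesis .
qed

section \<open>Euler steps and their distance from the flow\<close>

definition euler :: "real \<Rightarrow> 'a \<Rightarrow> 'a" where
  "euler h x = x + h *\<^sub>R F x"

lemma euler_lipschitz: "0 \<le> h \<Longrightarrow> norm (euler h x - euler h y) \<le> (1 + h * L) * norm (x - y)"
proof -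
  assume h: "0 \<le> h"
  have "norm (euler h x - euler h y) \<le> norm (x - y) + norm (h *\<^sub>R (F x - F y))"
    unfolding euler_def by (rule order_trans[OF eq_refl norm_triangle_ineq]) (simp add: algebra_simps)
  also have "\<dots> \<le> norm (x - y) + h * (L * norm (x - y))"
    using h F_lipschitz by (simp add: mult_left_mono)
  finally show ?thesis by (simp add: algebra_simps)
qed

text \<open>During one step the trajectory moves by at most \<open>M * h\<close>, so the field along
  it differs from its initial value by at most \<open>L * M * h\<close>; integrating over a time
  \<open>h\<close> gives the second factor \<open>h\<close>.\<close>

lemma euler_local_error:
  assumes h: "0 \<le> h"
  shows "norm (trajectory x h - euler h x) \<le> L * M * h\<^sup>2"
proof (cases "h = 0")
  case False
  with h have "0 < h" by simp
  define g where "g t = trajectory x t - t *\<^sub>R F x" for t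
  have g: "(g has_vector_derivative F (trajectory x t) - F x) (at t)" for t
    unfolding g_def by (auto intro!: derivative_eq_intros trajectory_deriv)
  have "norm (g h - g 0) \<le> (L * M * h) * h - (L * M * h) * 0"
  proof (rule differentiable_bound_general[OF \<open>0 < h\<close>, of g "\<lambda>t. (L * M * h) * t"])
    show "continuous_on {0..h} g"
      by (meson g continuous_at_imp_continuous_on has_vector_derivative_continuous)
    fix t assume t: "0 < t" "t < h"
    show "(g has_vector_derivative F (trajectory x t) - F x) (at t)" by (rule g)
    have "norm (F (trajectory x t) - F x) \<le> L * norm (trajectory x t - x)"
      by (rule F_lipschitz)
    also have "norm (trajectory x t - x) \<le> M * t"
      using trajectory_speed[of x t 0] t by simp
    also have "M * t \<le> M * h"
      using t M_nonneg by (intro mult_left_mono) auto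
    finally show "norm (F (trajectory x t) - F x) \<le> L * M * h"
      using L_pos by (simp add: mult_ac)
  qed (auto intro!: continuous_intros derivative_eq_intros simp: has_vector_derivative_def)
  then show ?thesis
    by (simp add: g_def euler_def power2_eq_square mult_ac diff_diff_eq add.commute)
qed (simp add: euler_def)

text \<open>Each step adds one local error, measured at the exact trajectory, and multiplies the
  error already present by the Lipschitz constant \<open>1 + h * L\<close> of the Euler map.\<close>

lemma euler_global_error:
  assumes h: "0 \<le> h"
  shows "norm (trajectory x (real m * h) - (euler h ^^ m) x) \<le> real m * (L * M * h\<^sup>2) * (1 + h * L) ^ m"
proof (induction m)
  case (Suc m)
  let ?y = "trajectory x (real m * h)" and ?z = "(euler h ^^ m) x"
  have "norm (trajectory ?y h - euler h ?z)
      \<le> norm (trajectory ?y h - euler h ?y) + norm (euler h ?y - euler h ?z)"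
    by (rule order_trans[OF eq_refl norm_triangle_ineq]) simp
  also have "\<dots> \<le> L * M * h\<^sup>2 + (1 + h * L) * norm (?y - ?z)"
    using h by (intro add_mono euler_local_error euler_lipschitz)
  also have "\<dots> \<le> L * M * h\<^sup>2 * (1 + h * L) ^ Suc m + (1 + h * L) * (real m * (L * M * h\<^sup>2) * (1 + h * L) ^ m)"
  proof (intro add_mono mult_left_mono Suc)
    have "1 \<le> (1 + h * L) ^ Suc m"
      using h L_pos by (intro one_le_power) simp
    then have "L * M * h\<^sup>2 * 1 \<le> L * M * h\<^sup>2 * (1 + h * L) ^ Suc m"
      using L_pos M_nonneg by (intro mult_left_mono) auto
    then show "L * M * h\<^sup>2 \<le> L * M * h\<^sup>2 * (1 + h * L) ^ Suc m" by simp
  qed (use h L_pos in auto)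
  also have "\<dots> = real (Suc m) * (L * M * h\<^sup>2) * (1 + h * L) ^ Suc m"
    by (simp add: algebra_simps)
  finally show ?case
    using trajectory_add[of x "real m * h" h] by (simp add: algebra_simps)
qed simp

end

section \<open>Potentials along Euler orbits\<close>

text \<open>\<open>A\<close> bounds the derivative and \<open>B\<close> is a Lipschitz constant for
  it. Both are explicit parameters because uniformity in the step size depends on following them
  through N compositions.\<close>

definition C11 :: "real \<Rightarrow> real \<Rightarrow> ('a::real_normed_vector \<Rightarrow> 'b::real_normed_vector) \<Rightarrow> bool" where
  "C11 A B u \<longleftrightarrow> 0 \<le> A \<and> 0 \<le> B \<and>
     (\<exists>u'. (\<forall>x. (u has_derivative u' x) (at x)) \<and> (\<forall>x k. norm (u' x k) \<le> A * norm k) \<and>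
       (\<forall>x y k. norm (u' x k - u' y k) \<le> B * norm (x - y) * norm k))"

lemma C11_E:
  assumes "C11 A B u"
  obtains u' where "0 \<le> A" "0 \<le> B" "\<And>x. (u has_derivative u' x) (at x)"
    "\<And>x k. norm (u' x k) \<le> A * norm k"
    "\<And>x y k. norm (u' x k - u' y k) \<le> B * norm (x - y) * norm k"
  using assms unfolding C11_def by blast

lemma C11_mono:
  assumes u: "C11 A B u" and "A \<le> A'" "B \<le> B'"
  shows "C11 A' B' u"
proof -
  obtain u' where "0 \<le> A" "0 \<le> B" and d: "\<And>x. (u has_derivative u' x) (at x)"
    and b: "\<And>x k. norm (u' x k) \<le> A * norm k"
    and l: "\<And>x y k. norm (u' x k - u' y k) \<le> B * norm (x - y) * norm k"
    using C11_E[OF u] by metis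
  moreover have "norm (u' x k) \<le> A' * norm k" for x k
    by (rule order_trans[OF b]) (simp add: assms mult_right_mono)
  moreover have "norm (u' x k - u' y k) \<le> B' * norm (x - y) * norm k" for x y k
    by (rule order_trans[OF l]) (simp add: assms mult_right_mono)
  ultimately show ?thesis
    unfolding C11_def using assms by (intro conjI exI[of _ u'] allI) auto
qed

lemma C11_scaled_sum:
  assumes "finite I" and "\<And>i. i \<in> I \<Longrightarrow> C11 A B (u i)" and "\<And>i. i \<in> I \<Longrightarrow> 0 \<le> c i" "0 \<le> A" "0 \<le> B"
  shows "C11 (sum c I * A) (sum c I * B) (\<lambda>x. \<Sum>i\<in>I. c i *\<^sub>R u i x)"
proof -
  have "\<exists>v'. (\<forall>x. (u i has_derivative v' x) (at x)) \<and> (\<forall>x k. norm (v' x k) \<le> A * norm k) \<and>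
       (\<forall>x y k. norm (v' x k - v' y k) \<le> B * norm (x - y) * norm k)" if "i \<in> I" for i
    using assms(2)[OF that] unfolding C11_def by blast
  then obtain u' where d: "\<And>i x. i \<in> I \<Longrightarrow> (u i has_derivative u' i x) (at x)"
    and b: "\<And>i x k. i \<in> I \<Longrightarrow> norm (u' i x k) \<le> A * norm k"
    and l: "\<And>i x y k. i \<in> I \<Longrightarrow> norm (u' i x k - u' i y k) \<le> B * norm (x - y) * norm k"
    by metis
  show ?thesis
    unfolding C11_def
  proof (intro conjI exI allI)
    show "((\<lambda>x. \<Sum>i\<in>I. c i *\<^sub>R u i x) has_derivative (\<lambda>k. \<Sum>i\<in>I. c i *\<^sub>R u' i x k)) (at x)" for x
      by (intro has_derivative_sum has_derivative_scaleR_right d)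
    show "norm (\<Sum>i\<in>I. c i *\<^sub>R u' i x k) \<le> sum c I * A * norm k" for x k
      unfolding mult.assoc sum_distrib_right
      by (rule sum_norm_le) (use b assms(3) in \<open>simp add: mult_left_mono\<close>)
    show "norm ((\<Sum>i\<in>I. c i *\<^sub>R u' i x k) - (\<Sum>i\<in>I. c i *\<^sub>R u' i y k)) \<le> sum c I * B * norm (x - y) * norm k" for x y k
      unfolding mult.assoc sum_distrib_right sum_subtractf[symmetric] scaleR_diff_right[symmetric]
      by (rule sum_norm_le) (use l assms(3) in \<open>simp add: mult_left_mono flip: mult.assoc\<close>,
         metis assms(3) l mult.assoc mult_left_mono)
  qed (use assms in \<open>auto intro!: mult_nonneg_nonneg sum_nonneg\<close>)
qed

text \<open>On the ball of radius \<open>norm v\<close> around \<open>x\<close> the derivative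
  differs from \<open>u' x\<close> by at most \<open>B * norm v\<close>, so the mean value
  inequality applies to the linearization error.\<close>

lemma C11_remainder:
  fixes u :: "'a::real_normed_vector \<Rightarrow> 'b::real_normed_vector"
  assumes d: "\<And>x. (u has_derivative u' x) (at x)"
    and l: "\<And>x y k. norm (u' x k - u' y k) \<le> B * norm (x - y) * norm k" and "0 \<le> B"
  shows "norm (u (x + v) - u x - u' x v) \<le> B * (norm v)\<^sup>2"
proof -
  have "norm (u (x + v) - u x - u' x ((x + v) - x)) \<le> norm ((x + v) - x) * (B * norm v)"
  proof (rule differentiable_bound_linearization[where S="cball x (norm v)" and f'=u'])
    show "x + t *\<^sub>R (x + v - x) \<in> cball x (norm v)" if "t \<in> {0..1}" for t
      using that by (auto simp: dist_norm mult_left_le_one_le)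
    show "(u has_derivative u' y) (at y within cball x (norm v))" for y
      by (rule has_derivative_at_withinI[OF d])
    show "onorm (u' y - u' x) \<le> B * norm v" if "y \<in> cball x (norm v)" for y
    proof (rule onorm_bound)
      show "0 \<le> B * norm v" using \<open>0 \<le> B\<close> by simp
      fix k
      have "norm (u' y k - u' x k) \<le> B * norm (y - x) * norm k" by (rule l)
      also have "\<dots> \<le> B * norm v * norm k"
        using that \<open>0 \<le> B\<close> by (intro mult_right_mono mult_left_mono) (auto simp: dist_norm norm_minus_commute)
      finally show "norm ((u' y - u' x) k) \<le> B * norm v * norm k" by simp
    qed
  qed simp
  then show ?thesis by (simp add: power2_eq_square mult_ac)
qed

locale bounded_C11_field = bounded_lipschitz_field +
  fixes K :: real
  assumes F_C11: "C11 L K F"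
begin

text \<open>By the chain rule the derivative is \<open>u'\<close> at the Euler image applied to
  \<open>k + h *\<^sub>R F' x k\<close>. Changing the base point of \<open>u'\<close> costs
  \<open>B\<close> with one factor \<open>1 + h * L\<close> from the points and one from the vector;
  changing \<open>F'\<close> costs \<open>A * (h * K)\<close>.\<close>

lemma C11_comp_euler:
  assumes u: "C11 A B u" and h: "0 \<le> h"
  shows "C11 (A * (1 + h * L)) (B * (1 + h * L)\<^sup>2 + A * (h * K)) (\<lambda>x. u (euler h x))"
proof -
  obtain u' where A: "0 \<le> A" and B: "0 \<le> B" and du: "\<And>x. (u has_derivative u' x) (at x)"
    and bu: "\<And>x k. norm (u' x k) \<le> A * norm k"
    and lu: "\<And>x y k. norm (u' x k - u' y k) \<le> B * norm (x - y) * norm k"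
    using C11_E[OF u] by metis
  obtain F' where K: "0 \<le> K" and dF: "\<And>x. (F has_derivative F' x) (at x)"
    and bF: "\<And>x k. norm (F' x k) \<le> L * norm k"
    and lF: "\<And>x y k. norm (F' x k - F' y k) \<le> K * norm (x - y) * norm k"
    using C11_E[OF F_C11] by metis
  let ?E' = "\<lambda>x k. k + h *\<^sub>R F' x k"
  have bE: "norm (?E' x k) \<le> (1 + h * L) * norm k" for x k
  proof -
    have "norm (?E' x k) \<le> norm k + h * norm (F' x k)"
      using h by (intro order_trans[OF norm_triangle_ineq]) simp
    also have "\<dots> \<le> norm k + h * (L * norm k)"
      using h bF by (intro add_left_mono mult_left_mono)
    finally show ?thesis by (simp add: algebra_simps)
  qed
  show ?thesis
    unfolding C11_def
  proof (intro conjI exI allI)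
    have dE: "(euler h has_derivative ?E' x) (at x)" for x
      unfolding euler_def[abs_def] by (auto intro!: derivative_eq_intros dF)
    show "((\<lambda>x. u (euler h x)) has_derivative (\<lambda>k. u' (euler h x) (?E' x k))) (at x)" for x
      using diff_chain_at[OF dE du] by (simp add: o_def)
    show "norm (u' (euler h x) (?E' x k)) \<le> A * (1 + h * L) * norm k" for x k
      using order_trans[OF bu mult_left_mono[OF bE A]] by (simp add: mult.assoc)
    fix x y k
    interpret u': bounded_linear "u' (euler h y)"
      using du by (rule has_derivative_bounded_linear)
    let ?k = "?E' x k"
    have "norm (u' (euler h x) ?k - u' (euler h y) (?E' y k))
        = norm ((u' (euler h x) ?k - u' (euler h y) ?k) + u' (euler h y) (h *\<^sub>R (F' x k - F' y k)))"
      by (simp add: u'.add u'.scaleR u'.diff algebra_simps)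
    also have "\<dots> \<le> B * norm (euler h x - euler h y) * norm ?k + A * norm (h *\<^sub>R (F' x k - F' y k))"
      by (intro order_trans[OF norm_triangle_ineq] add_mono lu bu)
    also have "\<dots> \<le> B * ((1 + h * L) * norm (x - y)) * ((1 + h * L) * norm k)
        + A * (h * (K * norm (x - y) * norm k))"
      using A B h L_pos lF[of x k y]
      by (intro add_mono mult_mono mult_left_mono euler_lipschitz bE) (auto intro!: mult_left_mono mult_nonneg_nonneg)
    finally show "norm (u' (euler h x) ?k - u' (euler h y) (?E' y k))
        \<le> (B * (1 + h * L)\<^sup>2 + A * (h * K)) * norm (x - y) * norm k"
      by (simp add: power2_eq_square algebra_simps)
  qed (use A B K h L_pos in auto)
qed

text \<open>These constants depend on \<open>h\<close> only through \<open>(1 + h * L) ^ j\<close>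
  and \<open>real j * h\<close>, so they are bounded uniformly in \<open>h\<close> while
  \<open>real j * h\<close> stays below a fixed time.\<close>

lemma C11_euler_iterate:
  assumes u: "C11 A B u" and h: "0 \<le> h"
  shows "C11 (A * (1 + h * L) ^ j) ((1 + h * L) ^ (2 * j) * (B + real j * h * K * A)) (\<lambda>x. u ((euler h ^^ j) x))"
proof (induction j)
  case (Suc j)
  let ?q = "1 + h * L"
  have q: "1 \<le> ?q" using h L_pos by simp
  have A: "0 \<le> A" using u by (simp add: C11_def)
  have K: "0 \<le> K" using F_C11 by (simp add: C11_def)
  show ?case
  proof (rule C11_mono)
    show "C11 (A * ?q ^ j * ?q) (?q ^ (2 * j) * (B + real j * h * K * A) * ?q\<^sup>2 + A * ?q ^ j * (h * K))
        (\<lambda>x. u ((euler h ^^ Suc j) x))"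
      using C11_comp_euler[OF Suc h] by (simp add: funpow_swap1)
    \<comment> \<open>The power is raised to \<open>2 * Suc j\<close> only so that all contributions
      share one factor in the closed form.\<close>
    have "A * ?q ^ j * (h * K) \<le> A * ?q ^ (2 * Suc j) * (h * K)"
      using A K h q by (intro mult_right_mono mult_left_mono power_increasing) auto
    then show "?q ^ (2 * j) * (B + real j * h * K * A) * ?q\<^sup>2 + A * ?q ^ j * (h * K)
        \<le> ?q ^ (2 * Suc j) * (B + real (Suc j) * h * K * A)"
      by (simp add: algebra_simps power2_eq_square)
  qed (simp add: mult_ac)
qed (use u in simp)

text \<open>Summation by parts turns the weights \<open>1 - j / N\<close> into the uniform average over the orbit, up to
  the boundary term \<open>f x\<close>.\<close>

definition potential :: "('a \<Rightarrow> real) \<Rightarrow> real \<Rightarrow> nat \<Rightarrow> 'a \<Rightarrow> real" where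
  "potential f h N x = (\<Sum>j<N. (h * (1 - real j / real N)) *\<^sub>R f ((euler h ^^ j) x))"

lemma potential_euler:
  assumes "0 < N"
  shows "potential f h N (euler h x) - potential f h N x
    = h * ((\<Sum>j<N. f ((euler h ^^ Suc j) x)) / real N - f x)"
proof -
  define a where "a j = f ((euler h ^^ j) x)" for j
  \<comment> \<open>With a free upper limit the identity follows by induction; its boundary term
    \<open>(1 - real n / real N) * a n\<close> vanishes at \<open>n = N\<close>.\<close>
  have "(\<Sum>j<n. (1 - real j / real N) * (a (Suc j) - a j))
      = (\<Sum>j<n. a (Suc j)) / real N + (1 - real n / real N) * a n - a 0" for n
    by (induction n) (use assms in \<open>auto simp: add_divide_distrib diff_divide_distrib algebra_simps\<close>)
  from this[of N] have "(\<Sum>j<N. (1 - real j / real N) * (a (Suc j) - a j)) = (\<Sum>j<N. a (Suc j)) / real N - a 0"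
    using assms by simp
  moreover have "potential f h N (euler h x) - potential f h N x
      = h * (\<Sum>j<N. (1 - real j / real N) * (a (Suc j) - a j))"
    unfolding potential_def a_def sum_subtractf[symmetric] sum_distrib_left
    by (rule sum.cong) (auto simp: algebra_simps funpow_swap1)
  ultimately show ?thesis by (simp add: a_def)
qed

text \<open>The increment of the potential over one Euler step is exactly \<open>h\<close> times the
  orbit average minus \<open>f\<close>. Replacing the increment by the derivative costs a Taylor
  remainder, which is of order 1/N after division by \<open>h\<close>. It matters that
  \<open>C\<close> is chosen before \<open>N\<close>.\<close>

lemma potential_almost_solves:
  assumes f: "C11 A B f" and T: "0 < T"
  shows "\<exists>C. \<forall>N>0. \<exists>\<phi>'. (\<forall>x. (potential f (T / real N) N has_derivative \<phi>' x) (at x)) \<and>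
     (\<forall>k. continuous_on UNIV (\<lambda>x. \<phi>' x k)) \<and>
     (\<forall>x. f x + \<phi>' x (F x) \<le> (\<Sum>j<N. f ((euler (T / real N) ^^ Suc j) x)) / real N + C / real N)"
proof (rule exI[of _ "T * (exp (L * T) ^ 2 * (B + T * K * A)) * T * M\<^sup>2"], intro allI impI)
  define A1 where "A1 = A * exp (L * T)"
  \<comment> \<open>\<open>B1\<close> is a Lipschitz constant for the derivative of \<open>f\<close>
    composed with any iterate up to time T. The weights of the potential sum to at most T, so
    \<open>T * B1\<close> serves for its derivative; the witness is
    \<open>T * B1 * (h * M)\<^sup>2 / h\<close> with \<open>h = T / real N\<close>, up to the factor
    \<open>1 / real N\<close>.\<close>
  define B1 where "B1 = exp (L * T) ^ 2 * (B + T * K * A)"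
  fix N :: nat assume N: "0 < N"
  define h where "h = T / real N"
  have h: "0 < h" "real N * h = T" using T N by (auto simp: h_def)
  have A: "0 \<le> A" and B: "0 \<le> B" using f by (auto simp: C11_def)
  have K: "0 \<le> K" using F_C11 by (simp add: C11_def)
  have A1: "0 \<le> A1" and B1: "0 \<le> B1" using A B K T by (auto simp: A1_def B1_def)
  have pow: "(1 + h * L) ^ j \<le> exp (L * T)" if "j \<le> N" for j
  proof -
    have "(1 + h * L) ^ j \<le> (1 + h * L) ^ N"
      using that h L_pos by (intro power_increasing) auto
    also have "\<dots> \<le> exp (h * L) ^ N"
      using exp_ge_add_one_self[of "h * L"] h L_pos by (intro power_mono) auto
    finally show ?thesis
      using h(2) by (simp add: mult_ac flip: exp_of_nat_mult)
  qed
  have "C11 A1 B1 (\<lambda>x. f ((euler h ^^ j) x))" if "j \<in> {..<N}" for j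
  proof (rule C11_mono[OF C11_euler_iterate[OF f]])
    show "A * (1 + h * L) ^ j \<le> A1"
      unfolding A1_def using that A by (intro mult_left_mono pow) auto
    have "real j * h \<le> T" using that h by (auto simp flip: h(2))
    then show "(1 + h * L) ^ (2 * j) * (B + real j * h * K * A) \<le> B1"
      unfolding B1_def mult.commute[of 2 j] power_mult using that A B K h L_pos T
      by (intro mult_mono power_mono pow add_mono mult_right_mono) auto
  qed (use h in simp)
  then have "C11 ((\<Sum>j<N. h * (1 - real j / real N)) * A1) ((\<Sum>j<N. h * (1 - real j / real N)) * B1) (potential f h N)"
    unfolding potential_def[abs_def] using N h A1 B1 by (intro C11_scaled_sum) auto
  moreover have "(\<Sum>j<N. h * (1 - real j / real N)) \<le> T"
  proof -
    have "(\<Sum>j<N. h * (1 - real j / real N)) \<le> (\<Sum>j<N. h)"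
      using h by (intro sum_mono) (auto simp: mult_le_cancel_left1)
    then show ?thesis using h by simp
  qed
  ultimately have "C11 (T * A1) (T * B1) (potential f h N)"
    using A1 B1 by (elim C11_mono) (auto intro: mult_right_mono)
  then obtain \<phi>' where d: "\<And>x. (potential f h N has_derivative \<phi>' x) (at x)"
    and l: "\<And>x y k. norm (\<phi>' x k - \<phi>' y k) \<le> T * B1 * norm (x - y) * norm k"
    by (elim C11_E) metis
  show "\<exists>\<phi>'. (\<forall>x. (potential f (T / real N) N has_derivative \<phi>' x) (at x)) \<and>
     (\<forall>k. continuous_on UNIV (\<lambda>x. \<phi>' x k)) \<and>
     (\<forall>x. f x + \<phi>' x (F x) \<le> (\<Sum>j<N. f ((euler (T / real N) ^^ Suc j) x)) / real N
        + T * (exp (L * T) ^ 2 * (B + T * K * A)) * T * M\<^sup>2 / real N)"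
    unfolding h_def[symmetric] B1_def[symmetric]
  proof (intro exI conjI allI)
    show "(potential f h N has_derivative \<phi>' x) (at x)" for x by (rule d)
    fix k
    have "(T * B1 * norm k)-lipschitz_on UNIV (\<lambda>x. \<phi>' x k)"
      using l[of _ k] T B1 by (auto simp: lipschitz_on_def dist_norm mult_ac)
    then show "continuous_on UNIV (\<lambda>x. \<phi>' x k)"
      by (rule lipschitz_on_continuous_on)
  next
    fix x
    interpret bounded_linear "\<phi>' x" by (rule has_derivative_bounded_linear[OF d])
    have "norm (potential f h N (x + h *\<^sub>R F x) - potential f h N x - \<phi>' x (h *\<^sub>R F x)) \<le> T * B1 * (norm (h *\<^sub>R F x))\<^sup>2"
      by (rule C11_remainder[OF d l]) (use T B1 in auto)
    also have "\<dots> \<le> T * B1 * (h * M)\<^sup>2"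
      using T B1 h F_bounded M_nonneg by (intro mult_left_mono power_mono) (auto intro!: mult_left_mono)
    finally have "\<bar>h * ((\<Sum>j<N. f ((euler h ^^ Suc j) x)) / real N - f x) - h * \<phi>' x (F x)\<bar> \<le> h * (T * B1 * h * M\<^sup>2)"
      unfolding potential_euler[OF N, of f h x, unfolded euler_def[of h x], symmetric]
      by (simp add: scaleR power2_eq_square mult_ac)
    then have "h * \<bar>((\<Sum>j<N. f ((euler h ^^ Suc j) x)) / real N - f x) - \<phi>' x (F x)\<bar> \<le> h * (T * B1 * h * M\<^sup>2)"
      using h by (simp add: abs_mult flip: right_diff_distrib)
    then have "\<bar>((\<Sum>j<N. f ((euler h ^^ Suc j) x)) / real N - f x) - \<phi>' x (F x)\<bar> \<le> T * B1 * h * M\<^sup>2"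
      using h by simp
    moreover have "T * B1 * h * M\<^sup>2 = (T * B1 * T * M\<^sup>2) / real N"
      by (simp add: h_def)
    ultimately show "f x + \<phi>' x (F x) \<le> (\<Sum>j<N. f ((euler h ^^ Suc j) x)) / real N + (T * B1 * T * M\<^sup>2) / real N"
      by linarith
  qed
qed

end

section \<open>A space-filling curve\<close>

text \<open>Schoenberg's curve: if \<open>t\<close> has ternary digits \<open>0\<close> and \<open>2\<close> only, then \<open>digit_filter (3 ^ m * t)\<close> reads off
  whether digit \<open>m\<close> is \<open>2\<close>, and these bits are distributed over the binary expansions of the coordinates.\<close>

definition digit_filter :: "real \<Rightarrow> real" where
  "digit_filter x = max 0 (min 1 (1 / 2 - cos (pi * x)))"

lemma digit_filter_bounds: "0 \<le> digit_filter x" "digit_filter x \<le> 1"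
  by (auto simp: digit_filter_def)

lemma digit_filter_periodic: "digit_filter (2 * of_int k + r) = digit_filter r"
proof -
  have "cos (pi * (2 * of_int k + r)) = cos (pi * r)"
    using cos_int_2pin[of k] sin_int_2pin[of k]
    by (simp add: distrib_left cos_add mult_ac)
  then show ?thesis by (simp add: digit_filter_def)
qed

text \<open>Here \<open>cos (pi * r)\<close> is at least 1/2, which is where the shift 1/2 and the
  truncation at 0 come from.\<close>

lemma digit_filter_0: "0 \<le> r \<Longrightarrow> r \<le> 1 / 3 \<Longrightarrow> digit_filter r = 0"
proof -
  assume r: "0 \<le> r" "r \<le> 1 / 3"
  have "cos (pi / 3) \<le> cos (pi * r)"
    using r mult_left_mono[of r "1/3" pi] by (intro cos_monotone_0_pi_le) auto
  then show ?thesis by (simp add: digit_filter_def cos_60)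
qed

lemma digit_filter_1: "2 / 3 \<le> r \<Longrightarrow> r \<le> 1 \<Longrightarrow> digit_filter r = 1"
proof -
  assume r: "2 / 3 \<le> r" "r \<le> 1"
  have "cos (pi * r) \<le> cos (pi * (2 / 3))"
    using r mult_left_mono[of "2/3" r pi] mult_left_mono[of r 1 pi] by (intro cos_monotone_0_pi_le) auto
  then have "cos (pi * r) \<le> - 1 / 2" using cos_120' by simp
  then show ?thesis by (simp add: digit_filter_def)
qed

text \<open>Take t with ternary digits 2 or 0 according to \<open>a\<close>. Multiplication by
  \<open>3 ^ m\<close> moves the first m digits into the integer part, which is even because every
  digit is, and so is lost on a function of period 2. The remaining fraction \<open>R m\<close> lies
  in [2/3, 1] or [0, 1/3] according to its leading digit.\<close>

lemma ternary_code:
  fixes a :: "nat \<Rightarrow> bool"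
  shows "\<exists>t\<in>{0..1}. \<forall>m. digit_filter (3 ^ m * t) = of_bool (a m)"
proof -
  define R where "R m = (\<Sum>l. 2 * of_bool (a (m + l)) / 3 ^ Suc l :: real)" for m
  have geo: "(\<lambda>l. 2 / 3 ^ Suc l :: real) sums 1"
    using sums_mult[OF geometric_sums[of "1/3::real"], of "2/3"] by (simp add: power_divide)
  have smm: "summable (\<lambda>l. 2 * of_bool (a (m + l)) / 3 ^ Suc l :: real)" for m
    by (rule summable_comparison_test[OF _ sums_summable[OF geo]]) (auto intro!: exI[of _ 0])
  have R_nonneg: "0 \<le> R m" for m
    unfolding R_def by (intro suminf_nonneg smm) auto
  have R_le_1: "R m \<le> 1" for m
    unfolding R_def sums_unique[OF geo] by (intro suminf_le smm sums_summable[OF geo]) auto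
  have R_Suc: "3 * R m = 2 * of_bool (a m) + R (Suc m)" for m
  proof -
    have "R m = (\<Sum>l. 2 * of_bool (a (m + Suc l)) / 3 ^ Suc (Suc l)) + 2 * of_bool (a m) / 3"
      using suminf_split_head[OF smm[of m]] by (simp add: R_def)
    also have "(\<Sum>l. 2 * of_bool (a (m + Suc l)) / 3 ^ Suc (Suc l) :: real)
        = (\<Sum>l. (1 / 3) * (2 * of_bool (a (Suc m + l)) / 3 ^ Suc l))"
      by (rule suminf_cong) simp
    also have "\<dots> = (1 / 3) * R (Suc m)"
      unfolding R_def by (rule suminf_mult[OF smm])
    finally show ?thesis by simp
  qed
  have "\<exists>k::int. 3 ^ m * R 0 = 2 * of_int k + R m" for m
  proof (induction m)
    case 0
    show ?case by (intro exI[of _ 0]) simp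
  next
    case (Suc m)
    then obtain k :: int where "3 ^ m * R 0 = 2 * of_int k + R m" by blast
    then have "3 ^ Suc m * R 0 = 2 * of_int (3 * k) + 3 * R m" by simp
    then show ?case unfolding R_Suc by (intro exI[of _ "3 * k + of_bool (a m)"]) simp
  qed
  moreover have "digit_filter (R m) = of_bool (a m)" for m
    using R_Suc[of m] R_nonneg[of "Suc m"] R_le_1[of "Suc m"]
    by (cases "a m") (auto intro!: digit_filter_0 digit_filter_1)
  ultimately have "digit_filter (3 ^ m * R 0) = of_bool (a m)" for m
    by (metis digit_filter_periodic)
  then show ?thesis
    using R_nonneg[of 0] R_le_1[of 0] by (intro bexI[of _ "R 0"]) auto
qed

text \<open>The digits are read off from successive floors, so the partial sums are
  \<open>of_int (fl m) / 2 ^ m\<close>, within \<open>(1 / 2) ^ m\<close> of \<open>y\<close>. The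
  bound \<open>y < 1\<close> makes the floor at m = 0 vanish.\<close>

lemma binary_expansion:
  fixes y :: real
  assumes "0 \<le> y" "y < 1"
  shows "\<exists>b. (\<lambda>k. (1 / 2) ^ Suc k * of_bool (b k)) sums y"
proof -
  define fl where "fl k = \<lfloor>2 ^ k * y\<rfloor>" for k :: nat
  define b where "b k \<longleftrightarrow> fl (Suc k) = 2 * fl k + 1" for k
  have step: "fl (Suc k) = 2 * fl k + of_bool (b k)" for k
  proof -
    have "fl (Suc k) = 2 * fl k \<or> fl (Suc k) = 2 * fl k + 1"
      unfolding fl_def by (simp add: mult.assoc) linarith
    then show ?thesis by (auto simp: b_def)
  qed
  have part: "(\<Sum>k<m. (1 / 2) ^ Suc k * of_bool (b k)) = (of_int (fl m) / 2 ^ m :: real)" for m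
  proof (induction m)
    case 0
    have "fl 0 = 0" using assms by (simp add: fl_def floor_eq_iff)
    then show ?case by simp
  next
    case (Suc m)
    then show ?case by (simp add: step power_divide add_divide_distrib)
  qed
  have lim: "(\<lambda>m. y - (1 / 2) ^ m) \<longlonglongrightarrow> y - 0"
    by (intro tendsto_intros LIMSEQ_power_zero) simp
  have bounds: "y - (1 / 2) ^ m \<le> of_int (fl m) / 2 ^ m" "of_int (fl m) / 2 ^ m \<le> y" for m
  proof -
    have "2 ^ m * y - 1 \<le> of_int (fl m)" "of_int (fl m) \<le> 2 ^ m * y"
      unfolding fl_def by linarith+
    then have "(2 ^ m * y - 1) / 2 ^ m \<le> of_int (fl m) / 2 ^ m" "of_int (fl m) / 2 ^ m \<le> 2 ^ m * y / 2 ^ m"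
      by (intro divide_right_mono; simp)+
    moreover have "(2 ^ m * y - 1) / 2 ^ m = y - (1 / 2) ^ m"
      by (simp add: diff_divide_distrib power_one_over)
    ultimately show "y - (1 / 2) ^ m \<le> of_int (fl m) / 2 ^ m" "of_int (fl m) / 2 ^ m \<le> y"
      by simp_all
  qed
  have "(\<lambda>m. of_int (fl m) / 2 ^ m) \<longlonglongrightarrow> y"
    by (rule tendsto_sandwich[OF always_eventually always_eventually lim[unfolded diff_zero] tendsto_const])
      (intro allI bounds)+
  then show ?thesis
    by (intro exI[of _ b]) (simp only: sums_def part)
qed

text \<open>Coordinate i is a binary series whose bits are read from the ternary digits of t at
  positions congruent to \<open>\<iota> i\<close> modulo n. The half-open cube is enough, since it
  contains a representative of every point of the torus.\<close>

lemma space_filling_curve: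
  "\<exists>s :: real \<Rightarrow> real ^ 'n::finite. continuous_on UNIV s \<and>
     (\<forall>y. (\<forall>i. 0 \<le> y $ i \<and> y $ i < 1) \<longrightarrow> y \<in> s ` {0..1})"
proof -
  define n where "n = CARD('n)"
  obtain \<iota> :: "'n \<Rightarrow> nat" where \<iota>: "bij_betw \<iota> UNIV {..<n}"
    using ex_bij_betw_finite_nat[of "UNIV :: 'n set"] by (auto simp: n_def atLeast0LessThan)
  then have \<iota>_less: "\<iota> i < n" for i by (auto simp: bij_betw_def)
  have \<iota>_inv: "inv \<iota> (\<iota> i) = i" for i using \<iota> by (simp add: bij_betw_def)
  define c where "c i t = (\<Sum>k. (1 / 2) ^ Suc k * digit_filter (3 ^ (n * k + \<iota> i) * t))" for i t
  define s :: "real \<Rightarrow> real ^ 'n" where "s t = (\<chi> i. c i t)" for t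
  have "continuous_on UNIV (c i)" for i
  proof (rule uniform_limit_theorem)
    show "uniform_limit UNIV (\<lambda>m t. \<Sum>k<m. (1 / 2) ^ Suc k * digit_filter (3 ^ (n * k + \<iota> i) * t)) (c i) sequentially"
      unfolding c_def[abs_def]
    proof (rule Weierstrass_m_test)
      show "summable (\<lambda>k. (1 / 2 :: real) ^ Suc k)"
        unfolding summable_Suc_iff by (intro summable_geometric) simp
    qed (use digit_filter_bounds in \<open>auto simp: abs_mult mult_le_cancel_left1\<close>)
    show "\<forall>\<^sub>F m in sequentially. continuous_on UNIV
        (\<lambda>t. \<Sum>k<m. (1 / 2) ^ Suc k * digit_filter (3 ^ (n * k + \<iota> i) * t))"
      unfolding digit_filter_def by (intro always_eventually allI continuous_intros)
  qed simp
  then have "continuous_on UNIV s"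
    unfolding s_def[abs_def] by (intro continuous_on_vec_lambda)
  moreover have "y \<in> s ` {0..1}" if y: "\<forall>i. 0 \<le> y $ i \<and> y $ i < 1" for y
  proof -
    have "\<exists>b. (\<lambda>k. (1 / 2) ^ Suc k * of_bool (b k)) sums (y $ i)" for i
      using y by (intro binary_expansion) auto
    then obtain b where b: "\<And>i. (\<lambda>k. (1 / 2) ^ Suc k * of_bool (b i k)) sums (y $ i)"
      by metis
    \<comment> \<open>Position m stores bit \<open>m div n\<close> of the coordinate with number
      \<open>m mod n\<close>, so \<open>n * k + \<iota> i\<close> returns bit k of coordinate
      i.\<close>
    obtain t where t: "t \<in> {0..1}" "\<And>m. digit_filter (3 ^ m * t) = of_bool (b (inv \<iota> (m mod n)) (m div n))"
      using ternary_code[of "\<lambda>m. b (inv \<iota> (m mod n)) (m div n)"] by blast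
    have "c i t = y $ i" for i
      unfolding c_def t(2) using b[of i] \<iota>_less[of i] \<iota>_inv[of i] by (simp add: sums_iff)
    then have "s t = y" by (simp add: s_def vec_eq_iff)
    with t(1) show ?thesis by blast
  qed
  ultimately show ?thesis by blast
qed

section \<open>Periodic functions and measures on the torus\<close>

lemma torus_proj_eq_iff: "torus_proj x = torus_proj y \<longleftrightarrow> lattice_equiv x y"
  by (simp add: torus_proj_def torus.abs_eq_iff)

lemma torus_proj_rep: "torus_proj (rep_torus z) = z"
  unfolding torus_proj_def by (rule Quotient_abs_rep[OF Quotient_torus])

lemma torus_proj_add_cong:
  "torus_proj x = torus_proj y \<Longrightarrow> torus_proj (x + v) = torus_proj (y + v)"
  by (simp add: torus_proj_eq_iff lattice_equiv_def)

lemma torus_proj_translate: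
  "torus_proj x = torus_proj y \<Longrightarrow> torus_proj (z + (y - x)) = torus_proj z"
  unfolding torus_proj_eq_iff lattice_equiv_def
  by (metis Ints_minus add_diff_cancel_left' minus_diff_eq vector_add_component vector_minus_component)

lemma torus_proj_unit_cube:
  obtains x where "torus_proj x = z" "\<And>i. 0 \<le> x $ i \<and> x $ i < 1"
proof
  show "torus_proj (\<chi> i. frac (rep_torus z $ i)) = z"
  proof -
    have "torus_proj (\<chi> i. frac (rep_torus z $ i)) = torus_proj (rep_torus z)"
      unfolding torus_proj_eq_iff lattice_equiv_def by (auto simp: frac_def)
    then show ?thesis by (simp add: torus_proj_rep)
  qed
qed (simp add: frac_lt_1)

lemma torus_proj_continuous: "continuous_on S (torus_proj :: real ^ 'n::finite \<Rightarrow> 'n torus)"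
proof (rule continuous_on_subset)
  show "continuous_on UNIV (torus_proj :: real ^ 'n \<Rightarrow> 'n torus)"
    unfolding continuous_on_open_vimage[OF open_UNIV] by (auto simp: open_torus_def)
qed simp

text \<open>The universal property of the quotient topology.\<close>

lemma continuous_on_torus_iff:
  "continuous_on UNIV g \<longleftrightarrow> continuous_on UNIV (periodic_lift g)"
proof
  assume "continuous_on UNIV g"
  then show "continuous_on UNIV (periodic_lift g)"
    unfolding periodic_lift_def
    by (intro continuous_on_compose torus_proj_continuous) (rule continuous_on_subset, auto)
next
  assume "continuous_on UNIV (periodic_lift g)"
  then show "continuous_on UNIV g"
    unfolding continuous_on_open_vimage[OF open_UNIV]
    by (auto simp: open_torus_def periodic_lift_def vimage_comp)
qed

lemma closed_torus_proj_vimage: "closed A \<Longrightarrow> closed (torus_proj -` A)"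
  unfolding closed_def open_torus_def by (simp add: vimage_Compl)

text \<open>Phrased through the projection instead of integer translations, so that such functions
  descend to the torus by composition with \<open>rep_torus\<close>.\<close>

definition periodic :: "(real ^ 'n::finite \<Rightarrow> 'b) \<Rightarrow> bool" where
  "periodic u \<longleftrightarrow> (\<forall>x y. torus_proj x = torus_proj y \<longrightarrow> u x = u y)"

lemma periodicD: "periodic u \<Longrightarrow> torus_proj x = torus_proj y \<Longrightarrow> u x = u y"
  unfolding periodic_def by blast

lemma periodic_periodic_lift: "periodic (periodic_lift g)"
  unfolding periodic_def periodic_lift_def comp_def by metis

lemma periodic_lift_rep: "periodic u \<Longrightarrow> periodic_lift (\<lambda>z. u (rep_torus z)) = u"
  unfolding periodic_lift_def comp_def by (rule ext, erule periodicD) (rule torus_proj_rep)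

lemma periodic_unit_cube:
  fixes u :: "real ^ 'n::finite \<Rightarrow> 'b"
  assumes "periodic u"
  shows "\<exists>y\<in>cbox 0 1. u x = u y"
proof -
  obtain y :: "real ^ 'n" where "torus_proj y = torus_proj x" "\<And>i. 0 \<le> y $ i \<and> y $ i < 1"
    using torus_proj_unit_cube by blast
  then show ?thesis
    using periodicD[OF assms, of y x] by (intro bexI[of _ y]) (auto simp: mem_box_cart less_imp_le)
qed

lemma periodic_continuous_bounded:
  fixes u :: "real ^ 'n::finite \<Rightarrow> 'b::real_normed_vector"
  assumes "periodic u" "continuous_on UNIV u"
  shows "\<exists>B\<ge>0. \<forall>x. norm (u x) \<le> B"
proof -
  have "bounded (u ` cbox 0 1)"
    by (intro compact_imp_bounded compact_continuous_image compact_cbox continuous_on_subset[OF assms(2)]) simp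
  then obtain B where "\<And>y. y \<in> cbox 0 1 \<Longrightarrow> norm (u y) \<le> B"
    by (auto simp: bounded_iff)
  then have "norm (u x) \<le> B" for x
    using periodic_unit_cube[OF assms(1), of x] by auto
  then show ?thesis
    by (meson norm_ge_zero order_trans)
qed

lemma periodic_continuous_attains_sup:
  fixes u :: "real ^ 'n::finite \<Rightarrow> real"
  assumes "periodic u" "continuous_on UNIV u"
  shows "\<exists>x. \<forall>y. u y \<le> u x"
proof -
  have "cbox 0 1 \<noteq> ({} :: (real ^ 'n) set)"
    using periodic_unit_cube[OF assms(1), of 0] by auto
  then obtain x where "\<And>y. y \<in> cbox 0 1 \<Longrightarrow> u y \<le> u x"
    using continuous_attains_sup[OF compact_cbox _ continuous_on_subset[OF assms(2)], of 0 1] by auto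
  then show ?thesis
    by (metis periodic_unit_cube[OF assms(1)])
qed

section \<open>Derivative bounds for periodic functions\<close>

lemma periodic_frechet_derivative:
  fixes u :: "real ^ 'n::finite \<Rightarrow> 'b::real_normed_vector"
  assumes "periodic u" "\<And>x. u differentiable at x"
  shows "periodic (\<lambda>x. frechet_derivative u (at x) h)"
  unfolding periodic_def
proof (intro allI impI)
  fix x y :: "real ^ 'n"
  assume xy: "torus_proj x = torus_proj y"
  have "(u has_derivative frechet_derivative u (at y)) (at (x + (y - x)))"
    using assms(2)[of y] by (simp add: frechet_derivative_works)
  moreover have "((\<lambda>z. z + (y - x)) has_derivative (\<lambda>h. h)) (at x)"
    by (auto intro!: derivative_eq_intros)
  ultimately have "((\<lambda>z. u (z + (y - x))) has_derivative frechet_derivative u (at y)) (at x)"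
    using diff_chain_at[of "\<lambda>z. z + (y - x)" "\<lambda>h. h" x u "frechet_derivative u (at y)"]
    by (simp add: o_def)
  moreover have "u (z + (y - x)) = u z" for z
    by (rule periodicD[OF assms(1) torus_proj_translate[OF xy]])
  ultimately have "(u has_derivative frechet_derivative u (at y)) (at x)"
    by simp
  then show "frechet_derivative u (at x) h = frechet_derivative u (at y) h"
    by (metis frechet_derivative_at)
qed

text \<open>\<open>k_times_cont_diff\<close> controls the derivative in one fixed direction at a
  time, and so does compactness of the cube. This estimate combines the bounds for the basis
  directions into one for all directions.\<close>

lemma norm_linear_le_Basis:
  fixes D :: "'a::euclidean_space \<Rightarrow> 'b::real_normed_vector"
  assumes "linear D" "\<And>b. b \<in> Basis \<Longrightarrow> norm (D b) \<le> c b"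
  shows "norm (D h) \<le> sum c Basis * norm h"
proof -
  interpret linear D by fact
  have "D h = D (\<Sum>b\<in>Basis. (h \<bullet> b) *\<^sub>R b)"
    by (simp add: euclidean_representation)
  also have "\<dots> = (\<Sum>b\<in>Basis. (h \<bullet> b) *\<^sub>R D b)"
    by (simp add: sum scale)
  also have "norm \<dots> \<le> (\<Sum>b\<in>Basis. c b * norm h)"
  proof (rule sum_norm_le)
    fix b :: 'a assume b: "b \<in> Basis"
    have "0 \<le> c b" using assms(2)[OF b] norm_ge_zero order_trans by blast
    then show "norm ((h \<bullet> b) *\<^sub>R D b) \<le> c b * norm h"
      using mult_mono[OF assms(2)[OF b] Basis_le_norm[OF b, of h]] by (simp add: mult.commute)
  qed
  finally show ?thesis by (simp add: sum_distrib_right)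
qed

lemma k_times_cont_diff_Suc_differentiable:
  "k_times_cont_diff (Suc k) u \<Longrightarrow> u differentiable at x"
  by (simp add: differentiable_on_def)

lemma k_times_cont_diff_Suc_has_derivative:
  "k_times_cont_diff (Suc k) u \<Longrightarrow> (u has_derivative frechet_derivative u (at x)) (at x)"
  using k_times_cont_diff_Suc_differentiable frechet_derivative_works by blast

lemma periodic_C1_bounded_derivative:
  fixes u :: "real ^ 'n::finite \<Rightarrow> 'b::real_normed_vector"
  assumes per: "periodic u" and C1: "k_times_cont_diff (Suc 0) u"
  shows "\<exists>A\<ge>0. \<forall>x h. norm (frechet_derivative u (at x) h) \<le> A * norm h"
proof -
  note diff = k_times_cont_diff_Suc_differentiable[OF C1]
  have "\<exists>c\<ge>0. \<forall>x. norm (frechet_derivative u (at x) h) \<le> c" for h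
    using C1 by (intro periodic_continuous_bounded periodic_frechet_derivative per diff) simp
  then obtain c where c: "\<And>h. 0 \<le> c h" "\<And>h x. norm (frechet_derivative u (at x) h) \<le> c h"
    by metis
  show ?thesis
    by (intro exI[of _ "sum c Basis"] conjI allI norm_linear_le_Basis linear_frechet_derivative diff sum_nonneg c)
qed

lemma bounded_derivative_imp_lipschitz:
  fixes u :: "'a::real_normed_vector \<Rightarrow> 'b::real_normed_vector"
  assumes "\<And>x. (u has_derivative u' x) (at x)" "\<And>x h. norm (u' x h) \<le> A * norm h" "0 \<le> A"
  shows "norm (u x - u y) \<le> A * norm (x - y)"
  by (rule differentiable_bound[of UNIV u u']) (use assms in \<open>auto intro!: onorm_bound\<close>)

text \<open>For a fixed direction h the map sending x to
  \<open>frechet_derivative u (at x) h\<close> is itself periodic and C^1, hence Lipschitz; the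
  constants for the basis directions are then added up.\<close>

lemma periodic_C2_imp_C11:
  fixes u :: "real ^ 'n::finite \<Rightarrow> 'b::real_normed_vector"
  assumes per: "periodic u" and C2: "k_times_cont_diff (Suc (Suc 0)) u"
  shows "\<exists>A B. C11 A B u"
proof -
  note diff = k_times_cont_diff_Suc_differentiable[OF C2]
  let ?D = "\<lambda>x. frechet_derivative u (at x)"
  have C1: "k_times_cont_diff (Suc 0) (\<lambda>x. ?D x h)" for h
    using C2 by simp
  \<comment> \<open>The recursive definition passes from C^2 to C^1 only through this: the first
    derivative is continuous because it is differentiable.\<close>
  have "k_times_cont_diff 0 (\<lambda>x. ?D x h)" for h
  proof -
    have "continuous_on UNIV (\<lambda>x. ?D x h)"
      by (intro continuous_at_imp_continuous_on ballI differentiable_imp_continuous_within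
          k_times_cont_diff_Suc_differentiable[OF C1])
    then show ?thesis by simp
  qed
  then have "k_times_cont_diff (Suc 0) u"
    using C2 by simp
  then obtain A where A: "0 \<le> A" "\<And>x h. norm (?D x h) \<le> A * norm h"
    using periodic_C1_bounded_derivative[OF per] by metis
  have "\<exists>c\<ge>0. \<forall>x y. norm (?D x h - ?D y h) \<le> c * norm (x - y)" for h
  proof -
    obtain c where c: "0 \<le> c" "\<And>x k. norm (frechet_derivative (\<lambda>x. ?D x h) (at x) k) \<le> c * norm k"
      using periodic_C1_bounded_derivative[OF periodic_frechet_derivative[OF per diff] C1] by metis
    show ?thesis
      using bounded_derivative_imp_lipschitz[OF k_times_cont_diff_Suc_has_derivative[OF C1] c(2,1)] c(1)
      by blast
  qed
  then obtain c where c: "\<And>h. 0 \<le> c h" "\<And>h x y. norm (?D x h - ?D y h) \<le> c h * norm (x - y)"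
    by metis
  have "norm (?D x k - ?D y k) \<le> sum c Basis * norm (x - y) * norm k" for x y k
    unfolding sum_distrib_right[of c Basis "norm (x - y)"]
    by (rule norm_linear_le_Basis) (intro linear_compose_sub linear_frechet_derivative diff c)+
  then have "C11 A (sum c Basis) u"
    unfolding C11_def using A c(1)
    by (intro conjI exI[of _ ?D] allI sum_nonneg k_times_cont_diff_Suc_has_derivative[OF C2]) auto
  then show ?thesis by blast
qed

section \<open>Test functions with Lipschitz lifts, and limits of orbit averages\<close>

lemma periodic_lift_infdist:
  fixes A :: "'n::finite torus set"
  shows "periodic_lift (\<lambda>z. infdist (rep_torus z) (torus_proj -` A)) = (\<lambda>x. infdist x (torus_proj -` A))"
proof (rule periodic_lift_rep, unfold periodic_def, intro allI impI)
  let ?A = "torus_proj -` A"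
  have le: "infdist y ?A \<le> infdist x ?A" if xy: "torus_proj x = torus_proj y" for x y :: "real ^ 'n"
  proof (cases "?A = {}")
    case False
    show ?thesis
      unfolding infdist_notempty[OF False, of x]
    proof (rule cINF_greatest[OF False])
      fix a assume "a \<in> ?A"
      then have "a + (y - x) \<in> ?A"
        using torus_proj_translate[OF xy, of a] by simp
      from infdist_le[OF this, of y] show "infdist y ?A \<le> dist x a"
        by (simp add: dist_norm)
    qed
  qed (simp add: infdist_def)
  show "infdist x ?A = infdist y ?A" if "torus_proj x = torus_proj y" for x y :: "real ^ 'n"
    using le[OF that] le[OF that[symmetric]] by simp
qed

lemma lipschitz_on_imp_continuous_torus:
  fixes g :: "'n::finite torus \<Rightarrow> real"
  shows "c-lipschitz_on UNIV (periodic_lift g) \<Longrightarrow> continuous_on UNIV g"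
  unfolding continuous_on_torus_iff by (rule lipschitz_on_continuous_on)

text \<open>Closed sets generate the Borel sets and are stable under intersection. The indicator of
  a closed set is the pointwise limit of \<open>max 0 (1 - n d)\<close>, where d is the distance
  from its preimage in the covering space. Lipschitz test functions are the right class because
  Euler errors are measured by distances in that space.\<close>

lemma torus_measure_eqI:
  fixes \<mu> \<nu> :: "'n::finite torus measure"
  assumes "prob_space \<mu>" "prob_space \<nu>" and sets: "sets \<mu> = sets borel" "sets \<nu> = sets borel"
    and eq: "\<And>g :: 'n torus \<Rightarrow> real. \<exists>c. c-lipschitz_on UNIV (periodic_lift g) \<Longrightarrow>
      (\<And>z. \<bar>g z\<bar> \<le> 1) \<Longrightarrow> (LINT z|\<mu>. g z) = (LINT z|\<nu>. g z)"
  shows "\<mu> = \<nu>"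
proof -
  interpret \<mu>: prob_space \<mu> by fact
  interpret \<nu>: prob_space \<nu> by fact
  show ?thesis
  proof (rule measure_eqI_generator_eq[where E="Collect closed" and \<Omega>=UNIV and A="\<lambda>_. UNIV"])
    show "Int_stable (Collect closed :: 'n torus set set)"
      by (auto simp: Int_stable_def)
    show "sets \<mu> = sigma_sets UNIV (Collect closed)" "sets \<nu> = sigma_sets UNIV (Collect closed)"
      using sets by (simp_all add: borel_eq_closed)
    fix A :: "'n torus set" assume "A \<in> Collect closed"
    then have A: "closed A" by simp
    show "emeasure \<mu> A = emeasure \<nu> A"
    \<comment> \<open>The empty set is treated apart because \<open>infdist\<close> to it is 0 by
      convention, so the approximation would converge to 1.\<close>
    proof (cases "A = {}")
      case False
      define d where "d z = infdist (rep_torus z) (torus_proj -` A)" for z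
      have d_lift: "periodic_lift d = (\<lambda>x. infdist x (torus_proj -` A))"
        unfolding d_def by (rule periodic_lift_infdist)
      define g where "g n z = max 0 (1 - real n * d z)" for n z
      have lip: "(real n)-lipschitz_on UNIV (periodic_lift (g n))" for n
      proof (rule lipschitz_onI)
        fix x y :: "real ^ 'n"
        have "dist (periodic_lift (g n) x) (periodic_lift (g n) y)
            \<le> \<bar>real n * periodic_lift d x - real n * periodic_lift d y\<bar>"
          by (simp add: periodic_lift_def g_def dist_real_def)
        also have "\<dots> = real n * \<bar>periodic_lift d x - periodic_lift d y\<bar>"
          by (simp add: abs_mult flip: right_diff_distrib)
        also have "\<dots> \<le> real n * dist x y"
          unfolding d_lift by (intro mult_left_mono infdist_triangle_abs) auto
        finally show "dist (periodic_lift (g n) x) (periodic_lift (g n) y) \<le> real n * dist x y" .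
      qed simp
      have d_nonneg: "0 \<le> d z" for z by (simp add: d_def infdist_nonneg)
      have d_pos: "0 < d z" if "z \<notin> A" for z
      proof -
        obtain a where "a \<in> A" using False by blast
        then have "torus_proj -` A \<noteq> {}" by (metis empty_iff torus_proj_rep vimageI)
        then have "d z \<noteq> 0"
          unfolding d_def using in_closed_iff_infdist_zero[OF closed_torus_proj_vimage[OF A], of "rep_torus z"] that
          by (simp add: torus_proj_rep)
        then show ?thesis using d_nonneg[of z] by simp
      qed
      have d_zero: "d z = 0" if "z \<in> A" for z
        unfolding d_def using that by (intro infdist_zero) (simp add: torus_proj_rep)
      have bnd: "\<bar>g n z\<bar> \<le> 1" for n z
        using d_nonneg[of z] by (simp add: g_def)
      have lim: "(\<lambda>n. g n z) \<longlonglongrightarrow> indicator A z" for z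
      proof (cases "z \<in> A")
        case False
        obtain m :: nat where "1 / d z < real m" using reals_Archimedean2 by blast
        then have "1 < real m * d z" using d_pos[OF False] by (simp add: field_simps)
        moreover have "real m * d z \<le> real n * d z" if "m \<le> n" for n
          using that d_nonneg by (intro mult_right_mono) auto
        ultimately have "g n z = 0" if "m \<le> n" for n
          using that by (force simp: g_def)
        then have "\<forall>\<^sub>F n in sequentially. g n z = 0"
          unfolding eventually_sequentially by blast
        with False show ?thesis
          by (simp add: tendsto_eventually)
      qed (simp add: g_def d_zero)
      have conv: "(\<lambda>n. LINT z|\<rho>. g n z) \<longlonglongrightarrow> measure \<rho> A" if "prob_space \<rho>" "sets \<rho> = sets borel" for \<rho>
      proof -
        interpret \<rho>: prob_space \<rho> by fact
        have "A \<in> sets \<rho>" using A that(2) by simp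
        have "g n \<in> borel_measurable \<rho>" for n
          unfolding measurable_cong_sets[OF that(2) refl]
          by (intro borel_measurable_continuous_onI lipschitz_on_imp_continuous_torus[OF lip])
        then have "(\<lambda>n. LINT z|\<rho>. g n z) \<longlonglongrightarrow> (LINT z|\<rho>. indicator A z)"
          using bnd lim \<open>A \<in> sets \<rho>\<close>
          by (intro integral_dominated_convergence[where w="\<lambda>_. 1"]) auto
        then show ?thesis
          using \<open>A \<in> sets \<rho>\<close> by (simp add: sets.Int_space_eq2)
      qed
      have "measure \<mu> A = measure \<nu> A"
      proof (rule LIMSEQ_unique)
        show "(\<lambda>n. LINT z|\<mu>. g n z) \<longlonglongrightarrow> measure \<mu> A"
          by (rule conv) fact+
        have "(LINT z|\<mu>. g n z) = (LINT z|\<nu>. g n z)" for n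
          using lip bnd by (intro eq) blast+
        then show "(\<lambda>n. LINT z|\<mu>. g n z) \<longlonglongrightarrow> measure \<nu> A"
          using conv[OF \<open>prob_space \<nu>\<close> sets(2)] by simp
      qed
      then show ?thesis by (simp add: \<mu>.emeasure_eq_measure \<nu>.emeasure_eq_measure)
    qed simp
  qed (auto simp: \<mu>.emeasure_eq_measure)
qed

text \<open>A space-filling curve lifts the averages to probability measures on the unit interval, where
  Helly's selection theorem applies.\<close>

lemma torus_averages_subseq_converge:
  fixes y :: "nat \<Rightarrow> nat \<Rightarrow> 'n::finite torus" and N :: "nat \<Rightarrow> nat"
  assumes N: "\<And>k. 0 < N k"
  shows "\<exists>(r :: nat \<Rightarrow> nat) \<sigma>. strict_mono r \<and> prob_space \<sigma> \<and> sets \<sigma> = sets borel \<and>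
    (\<forall>g :: 'n torus \<Rightarrow> real. continuous_on UNIV g \<longrightarrow>
      (\<lambda>k. (\<Sum>j<N (r k). g (y (r k) j)) / real (N (r k))) \<longlonglongrightarrow> (LINT z|\<sigma>. g z))"
proof -
  obtain s :: "real \<Rightarrow> real ^ 'n" where s: "continuous_on UNIV s"
    and s_onto: "\<And>y. (\<And>i. 0 \<le> y $ i \<and> y $ i < 1) \<Longrightarrow> y \<in> s ` {0..1}"
    using space_filling_curve by metis
  define q where "q = torus_proj \<circ> s"
  have q: "continuous_on UNIV q"
    unfolding q_def by (intro continuous_on_compose s torus_proj_continuous)
  have "\<exists>t\<in>{0..1}. q t = z" for z
    using torus_proj_unit_cube[of z] s_onto unfolding q_def by (metis comp_apply imageE)
  \<comment> \<open>A mere choice of preimages suffices: \<open>\<tau>\<close> is only composed with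
    functions of the index j, and on a discrete measure every function is measurable.\<close>
  then obtain \<tau> where \<tau>: "\<And>z. \<tau> z \<in> {0..1}" "\<And>z. q (\<tau> z) = z"
    by metis
  define P where "P k = measure_pmf (pmf_of_set {..<N k})" for k
  define \<nu> where "\<nu> k = distr (P k) borel (\<lambda>j. \<tau> (y k j))" for k
  have \<nu>: "real_distribution (\<nu> k)" for k
    unfolding \<nu>_def P_def by (intro prob_space.real_distribution_distr measure_pmf.prob_space_axioms) simp
  have \<nu>_int: "(LINT t|\<nu> k. g (q t)) = (\<Sum>j<N k. g (y k j)) / real (N k)"
    if "continuous_on UNIV g" for g :: "'n torus \<Rightarrow> real" and k
  proof -
    have "continuous_on UNIV (\<lambda>t. g (q t))"
      by (rule continuous_on_compose2[OF that q]) auto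
    then have "(LINT t|\<nu> k. g (q t)) = (LINT j|P k. g (q (\<tau> (y k j))))"
      unfolding \<nu>_def P_def by (intro integral_distr borel_measurable_continuous_onI) auto
    also have "\<dots> = (\<Sum>j<N k. g (y k j)) / real (N k)"
      unfolding P_def using N[of k] by (subst integral_pmf_of_set) (auto simp: \<tau> lessThan_empty_iff)
    finally show ?thesis .
  qed
  have "tight \<nu>"
    unfolding tight_def
  proof (intro conjI allI impI \<nu>)
    fix \<epsilon> :: real assume "0 < \<epsilon>"
    \<comment> \<open>Tightness is formulated with intervals open on the left; the endpoint -1 makes
      room for the parameter value 0.\<close>
    have "measure (\<nu> k) {-1<..1} = measure (P k) UNIV" for k
    proof -
      have "\<tau> z \<in> {-1<..1}" for z
        using \<tau>(1)[of z] by simp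
      then have "(\<lambda>j. \<tau> (y k j)) -` {-1<..1} = UNIV"
        by blast
      then show ?thesis
        unfolding \<nu>_def P_def by (subst measure_distr) auto
    qed
    then have "measure (\<nu> k) {-1<..1} > 1 - \<epsilon>" for k
      using \<open>0 < \<epsilon>\<close> by (simp add: P_def)
    then show "\<exists>a b. a < b \<and> (\<forall>k. 1 - \<epsilon> < measure (\<nu> k) {a<..b})"
      by (intro exI[of _ "-1"] exI[of _ 1]) auto
  qed
  from tight_imp_convergent_subsubsequence[OF this strict_mono_id]
  obtain r \<nu>' where r: "strict_mono r" and \<nu>': "real_distribution \<nu>'" and conv: "weak_conv_m (\<lambda>k. \<nu> (r k)) \<nu>'"
    by (auto simp: o_def)
  interpret \<nu>': real_distribution \<nu>' by fact
  define \<sigma> where "\<sigma> = distr \<nu>' borel q"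
  have q_meas: "q \<in> measurable \<nu>' borel"
    using borel_measurable_continuous_onI[OF q] by simp
  have "prob_space \<sigma>"
    unfolding \<sigma>_def by (rule \<nu>'.prob_space_distr[OF q_meas])
  moreover have "(\<lambda>k. (\<Sum>j<N (r k). g (y (r k) j)) / real (N (r k))) \<longlonglongrightarrow> (LINT z|\<sigma>. g z)"
    if g: "continuous_on UNIV g" for g :: "'n torus \<Rightarrow> real"
  proof -
    obtain B where B: "\<And>x. norm (periodic_lift g x) \<le> B"
      using periodic_continuous_bounded[OF periodic_periodic_lift g[unfolded continuous_on_torus_iff]] by blast
    have "continuous_on UNIV (\<lambda>t. g (q t))"
      by (rule continuous_on_compose2[OF g q]) auto
    then have "(\<lambda>k. LINT t|\<nu> (r k). g (q t)) \<longlonglongrightarrow> (LINT t|\<nu>'. g (q t))"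
      using B by (intro weak_conv_imp_integral_bdd_continuous_conv[where B=B] \<nu> \<nu>' conv)
        (auto simp: q_def periodic_lift_def continuous_on_eq_continuous_at)
    moreover have "(LINT z|\<sigma>. g z) = (LINT t|\<nu>'. g (q t))"
      unfolding \<sigma>_def by (intro integral_distr q_meas borel_measurable_continuous_onI g)
    ultimately show ?thesis
      by (simp add: \<nu>_int[OF g])
  qed
  ultimately show ?thesis
    using r by (intro exI[of _ r] exI[of _ \<sigma>]) (simp add: \<sigma>_def)
qed

section \<open>The flow on the torus and the cell value\<close>

locale torus_field = bounded_C11_field "periodic_lift V" L M K
  for V :: "'n::finite torus \<Rightarrow> real ^ 'n" and L M K
begin

lemma trajectory_translate:
  assumes "torus_proj x = torus_proj y"
  shows "trajectory y t = trajectory x t + (y - x)"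
proof -
  have "solution (\<lambda>t. trajectory x t + (y - x))"
    unfolding solution_def
  proof
    fix t
    have "periodic_lift V (trajectory x t + (y - x)) = periodic_lift V (trajectory x t)"
      by (rule periodicD[OF periodic_periodic_lift torus_proj_translate[OF assms]])
    then show "((\<lambda>t. trajectory x t + (y - x)) has_vector_derivative
        periodic_lift V (trajectory x t + (y - x))) (at t)"
      using trajectory_deriv[of x t] by (auto intro!: derivative_eq_intros)
  qed
  from trajectory_unique[OF this] show ?thesis
    by (simp add: fun_eq_iff)
qed

lemma trajectory_proj_cong:
  assumes "torus_proj x = torus_proj y"
  shows "torus_proj (trajectory x t) = torus_proj (trajectory y t)"
  unfolding trajectory_translate[OF assms] by (rule torus_proj_translate[OF assms, symmetric])

lemma integral_curve_trajectory: "integral_curve V (\<lambda>t. torus_proj (trajectory x t))"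
  unfolding integral_curve_def
  using trajectory_deriv by (intro exI[of _ "trajectory x"]) (auto simp: periodic_lift_def comp_def)

text \<open>The lift of \<open>\<xi>\<close> may start at a representative other than
  \<open>x\<close>; trajectories from two representatives differ by a constant lattice vector and
  have the same projection.\<close>

lemma integral_curve_unique:
  assumes "integral_curve V \<xi>" "\<xi> 0 = torus_proj x"
  shows "\<xi> = (\<lambda>t. torus_proj (trajectory x t))"
proof -
  obtain \<eta> where \<eta>: "\<xi> = torus_proj \<circ> \<eta>" "\<And>t. (\<eta> has_vector_derivative V (\<xi> t)) (at t)"
    using assms(1) unfolding integral_curve_def by blast
  have "V (\<xi> t) = periodic_lift V (\<eta> t)" for t
    by (simp add: \<eta>(1) periodic_lift_def)
  then have "solution \<eta>"
    using \<eta>(2) unfolding solution_def by simp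
  then have eq: "\<eta> = trajectory (\<eta> 0)"
    by (rule trajectory_unique)
  have start: "torus_proj (\<eta> 0) = torus_proj x"
    using assms(2) \<eta>(1) by simp
  show ?thesis
  proof
    fix t
    have "\<xi> t = torus_proj (trajectory (\<eta> 0) t)"
      unfolding \<eta>(1) comp_apply by (rule arg_cong[OF fun_cong[OF eq]])
    also have "\<dots> = torus_proj (trajectory x t)"
      by (rule trajectory_proj_cong[OF start])
    finally show "\<xi> t = torus_proj (trajectory x t)" .
  qed
qed

lemma flow_torus_proj: "flow V t (torus_proj x) = torus_proj (trajectory x t)"
proof -
  have "(THE \<xi>. integral_curve V \<xi> \<and> \<xi> 0 = torus_proj x) = (\<lambda>t. torus_proj (trajectory x t))"
  proof (rule the_equality)
    show "integral_curve V (\<lambda>t. torus_proj (trajectory x t)) \<and> torus_proj (trajectory x 0) = torus_proj x"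
      using integral_curve_trajectory by simp
    show "\<xi> = (\<lambda>t. torus_proj (trajectory x t))" if "integral_curve V \<xi> \<and> \<xi> 0 = torus_proj x" for \<xi>
      using that integral_curve_unique by blast
  qed
  then show ?thesis by (simp add: flow_def)
qed

lemma flow_minus: "flow V t (flow V (- t) z) = z"
proof -
  obtain x where z: "z = torus_proj x" using torus_proj_rep by metis
  show ?thesis unfolding z flow_torus_proj using trajectory_minus[of x "- t"] by simp
qed

lemma flow_continuous: "continuous_on UNIV (flow V t)"
proof -
  have "continuous_on UNIV (\<lambda>x. torus_proj (trajectory x t))"
    by (rule continuous_on_compose2[OF torus_proj_continuous[of UNIV] trajectory_continuous]) auto
  then show ?thesis
    unfolding continuous_on_torus_iff periodic_lift_def comp_def flow_torus_proj .
qed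

lemma flow_measurable: "sets \<sigma> = sets borel \<Longrightarrow> flow V t \<in> measurable \<sigma> borel"
  unfolding measurable_cong_sets[OF _ refl]
  by (rule borel_measurable_continuous_onI[OF flow_continuous])

lemma V_continuous: "continuous_on UNIV V"
  unfolding continuous_on_torus_iff by (rule F_continuous)

lemma euler_proj_cong:
  assumes "torus_proj x = torus_proj y"
  shows "torus_proj ((euler h ^^ j) x) = torus_proj ((euler h ^^ j) y)"
proof (induction j)
  case (Suc j)
  let ?x = "(euler h ^^ j) x" and ?y = "(euler h ^^ j) y"
  have "periodic_lift V ?x = periodic_lift V ?y"
    by (rule periodicD[OF periodic_periodic_lift Suc])
  then show ?case
    using torus_proj_add_cong[OF Suc, of "h *\<^sub>R periodic_lift V ?y"]
    by (simp add: euler_def[of h ?x] euler_def[of h ?y])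
qed (use assms in simp)

text \<open>Rounding \<open>t\<close> down to a whole number of steps costs at most
  \<open>M * h\<close>. The remaining Euler error is of order \<open>h\<close> because the steps
  taken cover a time of at most \<open>t\<close>. The bound is uniform in \<open>x\<close>.\<close>

lemma euler_flow_error:
  assumes h: "0 < h" "h \<le> 1" and t: "0 \<le> t"
  shows "norm (trajectory x t - (euler h ^^ nat \<lfloor>t / h\<rfloor>) x) \<le> (M + t * L * M * exp (L * t)) * h"
proof -
  define m where "m = nat \<lfloor>t / h\<rfloor>"
  have "0 \<le> t / h" using h t by simp
  then have m: "real m \<le> t / h" "t / h < real m + 1"
    unfolding m_def by linarith+
  then have mh: "real m * h \<le> t" "t - real m * h \<le> h"
    using h by (auto simp: field_simps)
  have "norm (trajectory x t - trajectory x (real m * h)) \<le> M * h"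
    using trajectory_speed[of x t "real m * h"] mh mult_left_mono[OF mh(2) M_nonneg] by simp
  moreover have "norm (trajectory x (real m * h) - (euler h ^^ m) x) \<le> t * L * M * exp (L * t) * h"
  proof -
    have "(1 + h * L) ^ m \<le> exp (h * L) ^ m"
      using exp_ge_add_one_self[of "h * L"] h L_pos by (intro power_mono) auto
    also have "\<dots> = exp (L * (real m * h))"
      by (simp add: mult_ac flip: exp_of_nat_mult)
    also have "\<dots> \<le> exp (L * t)"
      using mh L_pos by simp
    finally have pow: "(1 + h * L) ^ m \<le> exp (L * t)" .
    have "real m * (L * M * h\<^sup>2) * (1 + h * L) ^ m = (real m * h) * ((L * M * h) * (1 + h * L) ^ m)"
      by (simp add: power2_eq_square mult_ac)
    also have "\<dots> \<le> t * ((L * M * h) * exp (L * t))"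
      using mh pow h t L_pos M_nonneg by (intro mult_mono mult_left_mono mult_nonneg_nonneg zero_le_power) auto
    finally show ?thesis
      using euler_global_error[of h x m] h by (simp add: mult_ac)
  qed
  ultimately have "norm (trajectory x t - (euler h ^^ m) x) \<le> M * h + t * L * M * exp (L * t) * h"
    by (rule norm_diff_triangle_le)
  then show ?thesis
    by (simp add: m_def algebra_simps)
qed

end

section \<open>The cell problem tested against potentials and invariant measures\<close>

lemma torus_Ck_1_iff: "\<phi> \<in> torus_Ck 1 \<longleftrightarrow> k_times_cont_diff (Suc 0) (periodic_lift \<phi>)"
  by (simp add: torus_Ck_def)

lemma inner_gradient:
  fixes f :: "real ^ 'n::finite \<Rightarrow> real"
  assumes "f differentiable at x"
  shows "v \<bullet> gradient f x = frechet_derivative f (at x) v"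
proof -
  interpret linear "frechet_derivative f (at x)"
    by (rule linear_frechet_derivative[OF assms])
  have "frechet_derivative f (at x) v = frechet_derivative f (at x) (\<Sum>i\<in>UNIV. v $ i *\<^sub>R axis i 1)"
    using basis_expansion[of v] by (simp add: scalar_mult_eq_scaleR)
  also have "\<dots> = (\<Sum>i\<in>UNIV. v $ i * frechet_derivative f (at x) (axis i 1))"
    by (simp add: sum scale)
  finally show ?thesis
    by (simp add: inner_vec_def gradient_def)
qed

lemma C11_inner:
  assumes "C11 A B u"
  shows "C11 (norm p * A) (norm p * B) (\<lambda>x. p \<bullet> u x)"
proof -
  obtain u' where A: "0 \<le> A" and B: "0 \<le> B" and d: "\<And>x. (u has_derivative u' x) (at x)"
    and b: "\<And>x k. norm (u' x k) \<le> A * norm k"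
    and l: "\<And>x y k. norm (u' x k - u' y k) \<le> B * norm (x - y) * norm k"
    using C11_E[OF assms] by metis
  have inner_le: "\<bar>p \<bullet> v\<bar> \<le> norm p * c" if "norm v \<le> c" for v c
    using Cauchy_Schwarz_ineq2[of p v] mult_left_mono[OF that, of "norm p"] by simp
  show ?thesis
    unfolding C11_def
  proof (intro conjI exI allI)
    show "((\<lambda>x. p \<bullet> u x) has_derivative (\<lambda>k. p \<bullet> u' x k)) (at x)" for x
      by (rule has_derivative_inner_right[OF d])
    show "norm (p \<bullet> u' x k) \<le> norm p * A * norm k" for x k
      using inner_le[OF b] by (simp add: mult.assoc)
    show "norm (p \<bullet> u' x k - p \<bullet> u' y k) \<le> norm p * B * norm (x - y) * norm k" for x y k
      using inner_le[OF l, of x k y] by (simp add: mult.assoc inner_diff_right)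
  qed (use A B in auto)
qed

context torus_field
begin

abbreviation cell_integrand :: "real ^ 'n \<Rightarrow> ('n torus \<Rightarrow> real) \<Rightarrow> real ^ 'n \<Rightarrow> real" where
  "cell_integrand p \<phi> x \<equiv> periodic_lift V x \<bullet> (p + gradient (periodic_lift \<phi>) x)"

lemma cell_integrand_eq:
  assumes "\<phi> \<in> torus_Ck 1"
  shows "cell_integrand p \<phi> x
    = p \<bullet> periodic_lift V x + frechet_derivative (periodic_lift \<phi>) (at x) (periodic_lift V x)"
  using inner_gradient[OF k_times_cont_diff_Suc_differentiable[OF assms[unfolded torus_Ck_1_iff]],
      of "periodic_lift V x"]
  by (simp add: inner_add_right inner_commute)

lemma cell_integrand_bdd_above:
  assumes "\<phi> \<in> torus_Ck 1"
  shows "bdd_above (range (cell_integrand p \<phi>))"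
proof -
  obtain A where A: "0 \<le> A" "\<And>x h. norm (frechet_derivative (periodic_lift \<phi>) (at x) h) \<le> A * norm h"
    using periodic_C1_bounded_derivative[OF periodic_periodic_lift assms[unfolded torus_Ck_1_iff]] by metis
  have "cell_integrand p \<phi> x \<le> norm p * M + A * M" for x
  proof -
    have "p \<bullet> periodic_lift V x \<le> norm p * M"
      using norm_cauchy_schwarz[of p] mult_left_mono[OF F_bounded norm_ge_zero] by (rule order_trans)
    moreover have "frechet_derivative (periodic_lift \<phi>) (at x) (periodic_lift V x) \<le> A * M"
      using A(2)[of x "periodic_lift V x"] mult_left_mono[OF F_bounded[of x] A(1)] by simp
    ultimately show ?thesis
      unfolding cell_integrand_eq[OF assms] by simp
  qed
  then show ?thesis by (rule bdd_aboveI2)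
qed

text \<open>The infimum is taken in the reals and needs a lower bound uniform in the test function:
  at a maximum point of its lift the gradient vanishes, and the integrand there is at least
  \<open>- (norm p * M)\<close>.\<close>

lemma cell_value_le:
  assumes "\<phi> \<in> torus_Ck 1"
  shows "cell_value V p \<le> (SUP x. cell_integrand p \<phi> x)"
  unfolding cell_value_def
proof (rule cINF_lower[OF _ assms])
  show "bdd_below ((\<lambda>\<phi>. SUP x. cell_integrand p \<phi> x) ` torus_Ck 1)"
  proof (rule bdd_belowI2)
    fix \<psi> :: "'n torus \<Rightarrow> real" assume \<psi>: "\<psi> \<in> torus_Ck 1"
    note C1 = \<psi>[unfolded torus_Ck_1_iff]
    have "continuous_on UNIV (periodic_lift \<psi>)"
      by (intro continuous_at_imp_continuous_on ballI differentiable_imp_continuous_within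
          k_times_cont_diff_Suc_differentiable[OF C1])
    then obtain x where x: "\<And>y. periodic_lift \<psi> y \<le> periodic_lift \<psi> x"
      using periodic_continuous_attains_sup[OF periodic_periodic_lift] by blast
    have "frechet_derivative (periodic_lift \<psi>) (at x) = (\<lambda>h. 0)"
      by (rule has_derivative_local_max[OF k_times_cont_diff_Suc_has_derivative[OF C1]])
        (simp add: x)
    then have "cell_integrand p \<psi> x = p \<bullet> periodic_lift V x"
      unfolding cell_integrand_eq[OF \<psi>] by simp
    moreover have "- (norm p * M) \<le> p \<bullet> periodic_lift V x"
      using Cauchy_Schwarz_ineq2[of p "periodic_lift V x"] mult_left_mono[OF F_bounded[of x] norm_ge_zero[of p]]
      by linarith
    ultimately show "- (norm p * M) \<le> (SUP x. cell_integrand p \<psi> x)"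
      using cSUP_upper[OF _ cell_integrand_bdd_above[OF \<psi>], of x p] by simp
  qed
qed

text \<open>The potential is periodic, since Euler steps respect the projection, and C^1, so it is
  an admissible test function. At a point where its cell integrand nearly reaches the cell value,
  the orbit average does so too.\<close>

lemma cell_value_le_euler_average:
  assumes T: "0 < T"
  shows "\<exists>C. \<forall>N>0. \<exists>x. cell_value V p - C / real N
    \<le> (\<Sum>j<N. p \<bullet> periodic_lift V ((euler (T / real N) ^^ Suc j) x)) / real N"
proof -
  define f where "f x = p \<bullet> periodic_lift V x" for x
  have f_per: "periodic f"
    unfolding f_def periodic_def using periodicD[OF periodic_periodic_lift[of V]] by metis
  have "C11 (norm p * L) (norm p * K) f"
    unfolding f_def[abs_def] by (rule C11_inner[OF F_C11])
  from potential_almost_solves[OF this T]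
  obtain C where C: "\<And>N. 0 < N \<Longrightarrow> \<exists>\<phi>'. (\<forall>x. (potential f (T / real N) N has_derivative \<phi>' x) (at x)) \<and>
     (\<forall>k. continuous_on UNIV (\<lambda>x. \<phi>' x k)) \<and>
     (\<forall>x. f x + \<phi>' x (periodic_lift V x) \<le> (\<Sum>j<N. f ((euler (T / real N) ^^ Suc j) x)) / real N + C / real N)"
    by blast
  \<comment> \<open>The added 1 pays for a point where the cell integrand exceeds the cell value
    minus 1/N, in place of a maximum point.\<close>
  have "\<exists>x. cell_value V p - (C + 1) / real N
    \<le> (\<Sum>j<N. p \<bullet> periodic_lift V ((euler (T / real N) ^^ Suc j) x)) / real N" if N: "0 < N" for N
  proof -
    define u where "u = potential f (T / real N) N"
    obtain u' where u': "\<And>x. (u has_derivative u' x) (at x)" "\<And>k. continuous_on UNIV (\<lambda>x. u' x k)"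
      and le: "\<And>x. f x + u' x (periodic_lift V x) \<le> (\<Sum>j<N. f ((euler (T / real N) ^^ Suc j) x)) / real N + C / real N"
      using C[OF N] unfolding u_def by blast
    have "periodic u"
      unfolding periodic_def u_def potential_def
      by (intro allI impI sum.cong refl arg_cong2[where f=scaleR] periodicD[OF f_per] euler_proj_cong)
    define \<phi> where "\<phi> z = u (rep_torus z)" for z
    have lift: "periodic_lift \<phi> = u"
      unfolding \<phi>_def by (rule periodic_lift_rep) fact
    have fd: "frechet_derivative u (at x) = u' x" for x
      using frechet_derivative_at[OF u'(1)] by simp
    have "u differentiable_on UNIV"
      unfolding differentiable_on_def using u'(1) by (auto simp: differentiable_def)
    then have \<phi>: "\<phi> \<in> torus_Ck 1"
      unfolding torus_Ck_1_iff lift using u'(2) by (simp add: fd)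
    have "cell_value V p - 1 / real N < (SUP x. cell_integrand p \<phi> x)"
      by (rule less_le_trans[OF _ cell_value_le[OF \<phi>]]) (use N in simp)
    then obtain x where "cell_value V p - 1 / real N < cell_integrand p \<phi> x"
      using less_cSUP_iff[OF UNIV_not_empty cell_integrand_bdd_above[OF \<phi>]] by blast
    also have "\<dots> = f x + u' x (periodic_lift V x)"
      using cell_integrand_eq[OF \<phi>, of x p] by (simp add: lift fd f_def)
    also note le[of x]
    finally show ?thesis
      by (intro exI[of _ x]) (simp add: f_def add_divide_distrib)
  qed
  then show ?thesis by blast
qed

text \<open>The difference quotients of \<open>\<phi>\<close> along the flow have integral zero by
  invariance, are bounded by \<open>A * M\<close>, and converge to the derivative along V. Dominated
  convergence passes this to the limit, and the integral of the cell integrand is at most its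
  supremum.\<close>

lemma invariant_measure_le:
  assumes \<sigma>: "\<sigma> \<in> invariant_measures V" and \<phi>: "\<phi> \<in> torus_Ck 1"
  shows "(LINT z|\<sigma>. p \<bullet> V z) \<le> (SUP x. cell_integrand p \<phi> x)"
proof -
  have sets: "sets \<sigma> = sets borel" and inv: "\<And>t. distr \<sigma> borel (flow V t) = \<sigma>" and "prob_space \<sigma>"
    using \<sigma> by (auto simp: invariant_measures_def)
  interpret prob_space \<sigma> by fact
  note C1 = \<phi>[unfolded torus_Ck_1_iff]
  let ?u = "periodic_lift \<phi>"
  obtain A where A: "0 \<le> A" "\<And>x h. norm (frechet_derivative ?u (at x) h) \<le> A * norm h"
    using periodic_C1_bounded_derivative[OF periodic_periodic_lift C1] by metis
  note deriv = k_times_cont_diff_Suc_has_derivative[OF C1]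
  note lip = bounded_derivative_imp_lipschitz[OF deriv A(2,1)]
  have u_cont: "continuous_on UNIV ?u"
    by (intro continuous_at_imp_continuous_on ballI has_derivative_continuous[OF deriv])
  have meas: "g \<in> borel_measurable \<sigma>" if "continuous_on UNIV g" for g :: "'n torus \<Rightarrow> real"
    unfolding measurable_cong_sets[OF sets refl] by (rule borel_measurable_continuous_onI[OF that])
  have \<phi>_cont: "continuous_on UNIV \<phi>"
    using u_cont by (simp add: continuous_on_torus_iff)
  obtain B where B: "\<And>x. norm (?u x) \<le> B"
    using periodic_continuous_bounded[OF periodic_periodic_lift u_cont] by blast
  have \<phi>_bnd: "norm (\<phi> z) \<le> B" for z
    using B[of "rep_torus z"] by (simp add: periodic_lift_def torus_proj_rep)
  have \<phi>_int: "integrable \<sigma> \<phi>"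
    by (rule integrable_const_bound[of _ B]) (use \<phi>_bnd meas[OF \<phi>_cont] in auto)
  define w where "w z = frechet_derivative ?u (at (rep_torus z)) (V z)" for z
  define \<delta> where "\<delta> n = 1 / real (Suc n)" for n
  have \<delta>: "0 < \<delta> n" for n by (simp add: \<delta>_def)
  define s where "s n z = (\<phi> (flow V (\<delta> n) z) - \<phi> z) / \<delta> n" for n z
  have \<phi>_flow: "\<phi> (flow V t z) = ?u (trajectory (rep_torus z) t)" for t z
    using flow_torus_proj[of t "rep_torus z"] by (simp add: periodic_lift_def torus_proj_rep)
  have s_meas: "s n \<in> borel_measurable \<sigma>" for n
    unfolding s_def
    by (intro borel_measurable_divide borel_measurable_diff borel_measurable_const meas
        continuous_on_compose2[OF \<phi>_cont flow_continuous] \<phi>_cont) auto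
  have s_lim: "(\<lambda>n. s n z) \<longlonglongrightarrow> w z" for z
  proof -
    let ?x = "rep_torus z"
    have "((?u \<circ> trajectory ?x) has_vector_derivative frechet_derivative ?u (at ?x) (periodic_lift V ?x)) (at 0)"
      using vector_derivative_diff_chain_within[of "trajectory ?x" _ 0 UNIV ?u "frechet_derivative ?u (at ?x)"]
        trajectory_deriv[of ?x 0] deriv[of ?x] by (auto intro: has_derivative_at_withinI)
    then have "((?u \<circ> trajectory ?x) has_real_derivative w z) (at 0)"
      by (simp add: has_real_derivative_iff_has_vector_derivative w_def periodic_lift_def torus_proj_rep)
    then have "((\<lambda>h. (?u (trajectory ?x h) - ?u ?x) / h) \<longlongrightarrow> w z) (at 0)"
      by (simp add: DERIV_def)
    moreover have "filterlim \<delta> (at 0) sequentially"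
      unfolding filterlim_at using LIMSEQ_Suc[OF lim_1_over_n] by (auto simp: \<delta>_def[abs_def])
    ultimately have "(\<lambda>n. (?u (trajectory ?x (\<delta> n)) - ?u ?x) / \<delta> n) \<longlonglongrightarrow> w z"
      by (rule filterlim_compose)
    then show ?thesis
      by (simp add: s_def \<phi>_flow) (simp add: periodic_lift_def torus_proj_rep)
  qed
  have s_bnd: "norm (s n z) \<le> A * M" for n z
  proof -
    let ?x = "rep_torus z"
    have "norm (\<phi> (flow V (\<delta> n) z) - \<phi> z) \<le> A * norm (trajectory ?x (\<delta> n) - ?x)"
      using lip[of "trajectory ?x (\<delta> n)" ?x] unfolding \<phi>_flow
      by (simp add: periodic_lift_def torus_proj_rep)
    also have "\<dots> \<le> A * (M * \<delta> n)"
      using trajectory_speed[of ?x "\<delta> n" 0] \<delta>[of n] A(1) by (intro mult_left_mono) auto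
    finally show ?thesis
      using \<delta>[of n] by (simp add: s_def field_simps)
  qed
  \<comment> \<open>\<open>w\<close> is defined through the arbitrary representatives
    \<open>rep_torus z\<close>; its measurability comes from being a pointwise limit.\<close>
  have w_meas: "w \<in> borel_measurable \<sigma>"
    by (rule borel_measurable_LIMSEQ_real[OF s_lim s_meas])
  have conv: "integrable \<sigma> w" "(\<lambda>n. LINT z|\<sigma>. s n z) \<longlonglongrightarrow> (LINT z|\<sigma>. w z)"
    by (rule integrable_dominated_convergence[OF w_meas s_meas integrable_const AE_I2[OF s_lim] AE_I2[OF s_bnd]])
      (rule integral_dominated_convergence[OF w_meas s_meas integrable_const AE_I2[OF s_lim] AE_I2[OF s_bnd]])
  have "(LINT z|\<sigma>. s n z) = 0" for n
  proof -
    have "(LINT z|\<sigma>. \<phi> (flow V (\<delta> n) z)) = (LINT z|distr \<sigma> borel (flow V (\<delta> n)). \<phi> z)"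
      by (rule integral_distr[symmetric, OF flow_measurable[OF sets] borel_measurable_continuous_onI[OF \<phi>_cont]])
    moreover have "integrable \<sigma> (\<lambda>z. \<phi> (flow V (\<delta> n) z))"
      using \<phi>_bnd by (intro integrable_const_bound[of _ B] meas continuous_on_compose2[OF \<phi>_cont flow_continuous]) auto
    ultimately show ?thesis
      using \<phi>_int inv by (simp add: s_def)
  qed
  then have w_int: "(LINT z|\<sigma>. w z) = 0"
    using conv(2) LIMSEQ_const_iff[of "0::real" "LINT z|\<sigma>. w z"] by simp
  have pV_cont: "continuous_on UNIV (\<lambda>z. p \<bullet> V z)"
    by (intro continuous_intros V_continuous)
  have pV_int: "integrable \<sigma> (\<lambda>z. p \<bullet> V z)"
  proof (rule integrable_const_bound[of _ "norm p * M"])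
    have "norm (p \<bullet> V z) \<le> norm p * M" for z
      using Cauchy_Schwarz_ineq2[of p "V z"] mult_left_mono[OF F_bounded[of "rep_torus z"] norm_ge_zero[of p]]
      by (simp add: periodic_lift_def torus_proj_rep)
    then show "AE z in \<sigma>. norm (p \<bullet> V z) \<le> norm p * M" by simp
  qed (rule meas[OF pV_cont])
  have "p \<bullet> V z + w z \<le> (SUP x. cell_integrand p \<phi> x)" for z
    using cSUP_upper[OF UNIV_I cell_integrand_bdd_above[OF \<phi>], of "rep_torus z" p]
    unfolding cell_integrand_eq[OF \<phi>, of "rep_torus z" p] by (simp add: w_def periodic_lift_def torus_proj_rep)
  then have "(LINT z|\<sigma>. p \<bullet> V z + w z) \<le> (SUP x. cell_integrand p \<phi> x)"
    using pV_int conv(1) by (intro integral_le_const) auto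
  then show ?thesis
    using pV_int conv(1) w_int by simp
qed

end

section \<open>Invariant measures from Euler orbits\<close>

text \<open>A shift by one index gains one term and loses one, so the change does not depend on the
  number of terms.\<close>

lemma abs_shifted_sum_diff_le:
  fixes a :: "nat \<Rightarrow> real"
  assumes "\<And>j. \<bar>a j\<bar> \<le> B"
  shows "\<bar>(\<Sum>j<N. a (j + m)) - (\<Sum>j<N. a j)\<bar> \<le> 2 * real m * B"
proof (induction m)
  case (Suc m)
  have "(\<Sum>j<N. a (j + Suc m)) - (\<Sum>j<N. a (j + m)) = a (N + m) - a m"
    using sum_lessThan_telescope[of "\<lambda>j. a (j + m)" N] by (simp add: sum_subtractf)
  then show ?case
    using Suc assms[of "N + m"] assms[of m] by (simp add: algebra_simps)
qed simp

context torus_field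
begin

text \<open>Flowing for a time \<open>t\<close> is nearly a shift by \<open>t / h\<close> Euler
  steps, rounded down, and a shift affects only the ends of the orbit. After division by N the first
  term is of order \<open>h\<close> and the second is 2 t / (N h), so the limit requires both
  \<open>h\<close> to 0 and N h to infinity.\<close>

lemma euler_orbit_almost_invariant:
  assumes h: "0 < h" "h \<le> 1" and t: "0 \<le> t"
    and g: "c-lipschitz_on UNIV (periodic_lift g)" "\<And>z. \<bar>g z\<bar> \<le> 1"
  shows "\<bar>(\<Sum>j<N. g (flow V t (torus_proj ((euler h ^^ Suc j) x))))
      - (\<Sum>j<N. g (torus_proj ((euler h ^^ Suc j) x)))\<bar>
    \<le> real N * (c * ((M + t * L * M * exp (L * t)) * h)) + 2 * (t / h)"
proof -
  define m where "m = nat \<lfloor>t / h\<rfloor>"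
  define a where "a j = g (torus_proj ((euler h ^^ Suc j) x))" for j
  have step: "\<bar>g (flow V t (torus_proj ((euler h ^^ Suc j) x))) - a (j + m)\<bar>
      \<le> c * ((M + t * L * M * exp (L * t)) * h)" for j
  proof -
    let ?z = "(euler h ^^ Suc j) x"
    have z: "(euler h ^^ Suc (j + m)) x = (euler h ^^ m) ?z"
      using funpow_add[of m "Suc j" "euler h"] by (simp add: add.commute)
    have "\<bar>g (flow V t (torus_proj ?z)) - a (j + m)\<bar>
        = dist (periodic_lift g (trajectory ?z t)) (periodic_lift g ((euler h ^^ m) ?z))"
      unfolding a_def flow_torus_proj z by (simp only: periodic_lift_def comp_apply dist_real_def)
    also have "\<dots> \<le> c * dist (trajectory ?z t) ((euler h ^^ m) ?z)"
      by (rule lipschitz_onD[OF g(1)]) auto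
    also have "\<dots> \<le> c * ((M + t * L * M * exp (L * t)) * h)"
      unfolding dist_norm m_def
      by (intro mult_left_mono euler_flow_error h t lipschitz_on_nonneg[OF g(1)])
    finally show ?thesis .
  qed
  have "\<bar>(\<Sum>j<N. g (flow V t (torus_proj ((euler h ^^ Suc j) x)))) - (\<Sum>j<N. a (j + m))\<bar>
      \<le> (\<Sum>j<N. c * ((M + t * L * M * exp (L * t)) * h))"
    unfolding sum_subtractf[symmetric] by (intro order_trans[OF sum_abs] sum_mono step)
  moreover have "\<bar>(\<Sum>j<N. a (j + m)) - (\<Sum>j<N. a j)\<bar> \<le> 2 * real m * 1"
    by (rule abs_shifted_sum_diff_le) (simp add: a_def g(2) del: funpow.simps)
  moreover have "real m \<le> t / h"
    using divide_nonneg_pos[OF t h(1)] unfolding m_def by linarith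
  ultimately show ?thesis
    unfolding a_def[symmetric] by simp
qed

text \<open>Negative \<open>t\<close> reduces to the positive time \<open>- t\<close>, applied to
  the test function g composed with the flow at time \<open>t\<close>. This is again Lipschitz on
  lifts, with the constant enlarged by \<open>exp (L * \<bar>t\<bar>)\<close>.\<close>

lemma invariant_measureI:
  assumes \<sigma>: "prob_space \<sigma>" "sets \<sigma> = sets borel"
    and inv: "\<And>t (g :: 'n torus \<Rightarrow> real) c. 0 \<le> t \<Longrightarrow> c-lipschitz_on UNIV (periodic_lift g) \<Longrightarrow>
      (\<And>z. \<bar>g z\<bar> \<le> 1) \<Longrightarrow> (LINT z|\<sigma>. g (flow V t z)) = (LINT z|\<sigma>. g z)"
  shows "\<sigma> \<in> invariant_measures V"
proof -
  have "distr \<sigma> borel (flow V t) = \<sigma>" for t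
  proof (rule torus_measure_eqI)
    show "prob_space (distr \<sigma> borel (flow V t))"
      by (rule prob_space.prob_space_distr[OF \<sigma>(1) flow_measurable[OF \<sigma>(2)]])
    fix g :: "'n torus \<Rightarrow> real"
    assume "\<exists>c. c-lipschitz_on UNIV (periodic_lift g)" and bnd: "\<And>z. \<bar>g z\<bar> \<le> 1"
    then obtain c where lip: "c-lipschitz_on UNIV (periodic_lift g)" by blast
    have "(LINT z|distr \<sigma> borel (flow V t). g z) = (LINT z|\<sigma>. g (flow V t z))"
      by (intro integral_distr flow_measurable \<sigma>(2) borel_measurable_continuous_onI
          lipschitz_on_imp_continuous_torus[OF lip])
    also have "\<dots> = (LINT z|\<sigma>. g z)"
    proof (cases "0 \<le> t")
      case False
      have "(c * exp (L * \<bar>t\<bar>))-lipschitz_on UNIV (periodic_lift (\<lambda>z. g (flow V t z)))"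
      proof (rule lipschitz_onI)
        fix x y :: "real ^ 'n"
        have "dist (periodic_lift g (trajectory x t)) (periodic_lift g (trajectory y t))
            \<le> c * dist (trajectory x t) (trajectory y t)"
          by (rule lipschitz_onD[OF lip]) auto
        also have "\<dots> \<le> c * (exp (L * \<bar>t\<bar>) * dist x y)"
          unfolding dist_norm by (intro mult_left_mono trajectory_lipschitz lipschitz_on_nonneg[OF lip])
        finally show "dist (periodic_lift (\<lambda>z. g (flow V t z)) x) (periodic_lift (\<lambda>z. g (flow V t z)) y)
            \<le> c * exp (L * \<bar>t\<bar>) * dist x y"
          by (simp only: periodic_lift_def comp_apply flow_torus_proj mult.assoc)
      qed (use lipschitz_on_nonneg[OF lip] in simp)
      then have "(LINT z|\<sigma>. g (flow V t (flow V (- t) z))) = (LINT z|\<sigma>. g (flow V t z))"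
        using False bnd by (intro inv) auto
      then show ?thesis by (simp only: flow_minus)
    qed (rule inv[OF _ lip bnd])
    finally show "(LINT z|distr \<sigma> borel (flow V t). g z) = (LINT z|\<sigma>. g z)" .
  qed (simp_all add: \<sigma>)
  then show ?thesis
    using \<sigma> by (simp add: invariant_measures_def)
qed

text \<open>A diagonal choice: stage k uses orbits of length \<open>Suc k\<close>. Weak convergence
  carries both the lower bound on the averages and the asymptotic invariance to the limit
  measure.\<close>

lemma invariant_measure_exists:
  "\<exists>\<sigma>\<in>invariant_measures V. cell_value V p \<le> (LINT z|\<sigma>. p \<bullet> V z)"
proof -
  have "\<exists>C. \<forall>N>0. \<exists>x. cell_value V p - C / real N
      \<le> (\<Sum>j<N. p \<bullet> periodic_lift V ((euler (real (Suc k) / real N) ^^ Suc j) x)) / real N" for k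
    by (rule cell_value_le_euler_average) simp
  then obtain C where C: "\<And>k N. 0 < N \<Longrightarrow> \<exists>x. cell_value V p - C k / real N
      \<le> (\<Sum>j<N. p \<bullet> periodic_lift V ((euler (real (Suc k) / real N) ^^ Suc j) x)) / real N"
    by metis
  \<comment> \<open>The error constant \<open>C k\<close> depends on the orbit length, so the number
    of steps is fixed after it; the second requirement sends the step size to 0.\<close>
  have "\<exists>N>0. C k / real N \<le> 1 / real (Suc k) \<and> real (Suc k) / real N \<le> 1 / real (Suc k)" for k
  proof -
    obtain N :: nat where N: "max (C k * real (Suc k)) (real (Suc k) * real (Suc k)) < real N"
      using reals_Archimedean2 by blast
    then have "0 < real N"
      by (intro le_less_trans[OF _ N]) (simp add: le_max_iff_disj)
    then have "0 < N" by simp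
    then show ?thesis
      using N by (intro exI[of _ N]) (simp add: field_simps)
  qed
  then obtain N where N: "\<And>k. 0 < N k" "\<And>k. C k / real (N k) \<le> 1 / real (Suc k)"
      "\<And>k. real (Suc k) / real (N k) \<le> 1 / real (Suc k)"
    by metis
  define h where "h k = real (Suc k) / real (N k)" for k
  have h_pos: "0 < h k" for k using N(1)[of k] by (simp add: h_def)
  have h_le: "h k \<le> 1 / real (Suc k)" for k using N(3) by (simp add: h_def)
  have h_le_1: "h k \<le> 1" for k
    by (rule order_trans[OF h_le]) simp
  have "\<forall>k. \<exists>x. cell_value V p - C k / real (N k)
      \<le> (\<Sum>j<N k. p \<bullet> periodic_lift V ((euler (h k) ^^ Suc j) x)) / real (N k)"
    unfolding h_def by (rule allI, rule C[OF N(1)])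
  then obtain x where x: "\<And>k. cell_value V p - C k / real (N k)
      \<le> (\<Sum>j<N k. p \<bullet> periodic_lift V ((euler (h k) ^^ Suc j) (x k))) / real (N k)"
    unfolding choice_iff by blast
  define y where "y k j = torus_proj ((euler (h k) ^^ Suc j) (x k))" for k j
  obtain r \<sigma> where r: "strict_mono r" and \<sigma>: "prob_space \<sigma>" "sets \<sigma> = sets borel"
    and conv: "\<And>g :: 'n torus \<Rightarrow> real. continuous_on UNIV g \<Longrightarrow>
      (\<lambda>k. (\<Sum>j<N (r k). g (y (r k) j)) / real (N (r k))) \<longlonglongrightarrow> (LINT z|\<sigma>. g z)"
    using torus_averages_subseq_converge[of N y, OF N(1)] by blast
  have recip: "(\<lambda>k. b / real (Suc (r k))) \<longlonglongrightarrow> 0" for b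
  proof -
    have "(\<lambda>n. b * inverse (real (Suc n))) \<longlonglongrightarrow> b * 0"
      by (intro tendsto_intros LIMSEQ_inverse_real_of_nat)
    then show ?thesis
      using LIMSEQ_subseq_LIMSEQ[OF _ r] by (fastforce simp: o_def divide_inverse)
  qed
  have "cell_value V p \<le> (LINT z|\<sigma>. p \<bullet> V z)"
  proof (rule LIMSEQ_le)
    show "(\<lambda>k. cell_value V p - 1 / real (Suc (r k))) \<longlonglongrightarrow> cell_value V p"
      using tendsto_diff[OF tendsto_const recip, of "cell_value V p" 1] by simp
    show "(\<lambda>k. (\<Sum>j<N (r k). p \<bullet> V (y (r k) j)) / real (N (r k))) \<longlonglongrightarrow> (LINT z|\<sigma>. p \<bullet> V z)"
      by (intro conv continuous_intros V_continuous)
    have "cell_value V p - 1 / real (Suc (r k)) \<le> (\<Sum>j<N (r k). p \<bullet> V (y (r k) j)) / real (N (r k))" for k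
      using x[of "r k"] N(2)[of "r k"] by (simp add: y_def periodic_lift_def del: funpow.simps of_nat_Suc)
    then show "\<exists>n. \<forall>k\<ge>n. cell_value V p - 1 / real (Suc (r k)) \<le> (\<Sum>j<N (r k). p \<bullet> V (y (r k) j)) / real (N (r k))"
      by blast
  qed
  moreover have "\<sigma> \<in> invariant_measures V"
  proof (rule invariant_measureI[OF \<sigma>])
    fix t :: real and g :: "'n torus \<Rightarrow> real" and c
    assume t: "0 \<le> t" and lip: "c-lipschitz_on UNIV (periodic_lift g)" and bnd: "\<And>z. \<bar>g z\<bar> \<le> 1"
    note g_cont = lipschitz_on_imp_continuous_torus[OF lip]
    define D where "D = c * (M + t * L * M * exp (L * t))"
    have D: "0 \<le> D"
      unfolding D_def using t L_pos M_nonneg lipschitz_on_nonneg[OF lip] by simp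
    define a where "a k = (\<Sum>j<N k. g (flow V t (y k j))) / real (N k) - (\<Sum>j<N k. g (y k j)) / real (N k)" for k
    have "norm (a k) \<le> (D + 2 * t) / real (Suc k)" for k
    proof -
      have "norm (a k) = \<bar>(\<Sum>j<N k. g (flow V t (y k j))) - (\<Sum>j<N k. g (y k j))\<bar> / real (N k)"
        by (simp add: a_def abs_divide flip: diff_divide_distrib)
      also have "\<dots> \<le> (real (N k) * (c * ((M + t * L * M * exp (L * t)) * h k)) + 2 * (t / h k)) / real (N k)"
        unfolding y_def by (intro divide_right_mono euler_orbit_almost_invariant h_pos h_le_1 t lip bnd) simp
      \<comment> \<open>Steps times step size is the orbit length \<open>Suc k\<close>, which turns
        the boundary term into \<open>2 * t / real (Suc k)\<close>.\<close>
      also have "\<dots> = D * h k + 2 * t / real (Suc k)"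
      proof -
        have "(n * (c * (X * q)) + 2 * (t / q)) / n = c * X * q + 2 * t / (n * q)" if "0 < n" for n q X :: real
          using that by (simp add: add_divide_distrib mult.assoc mult.commute[of n])
        moreover have "real (N k) * h k = real (Suc k)"
          using N(1)[of k] by (simp add: h_def)
        ultimately show ?thesis
          using N(1)[of k] by (simp only: D_def of_nat_0_less_iff)
      qed
      also have "\<dots> \<le> D * (1 / real (Suc k)) + 2 * t / real (Suc k)"
        using D by (intro add_right_mono mult_left_mono h_le)
      finally show ?thesis by (simp add: add_divide_distrib)
    qed
    then have "(\<lambda>k. a (r k)) \<longlonglongrightarrow> 0"
      by (intro Lim_null_comparison[OF always_eventually recip]) blast
    moreover have "(\<lambda>k. a (r k)) \<longlonglongrightarrow> (LINT z|\<sigma>. g (flow V t z)) - (LINT z|\<sigma>. g z)"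
      unfolding a_def
      by (intro tendsto_diff conv g_cont continuous_on_compose2[OF g_cont flow_continuous]) auto
    ultimately show "(LINT z|\<sigma>. g (flow V t z)) = (LINT z|\<sigma>. g z)"
      using LIMSEQ_unique by fastforce
  qed
  ultimately show ?thesis by blast
qed

lemma cell_value_eq_max:
  "(\<exists>\<sigma>\<in>invariant_measures V. cell_value V p = (LINT z|\<sigma>. p \<bullet> V z)) \<and>
   (\<forall>\<sigma>\<in>invariant_measures V. (LINT z|\<sigma>. p \<bullet> V z) \<le> cell_value V p)"
proof -
  have "(\<lambda>_. 0) \<in> (torus_Ck 1 :: ('n torus \<Rightarrow> real) set)"
    unfolding torus_Ck_1_iff periodic_lift_def by (simp add: comp_def)
  then have "(torus_Ck 1 :: ('n torus \<Rightarrow> real) set) \<noteq> {}"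
    by blast
  then have le: "(LINT z|\<sigma>. p \<bullet> V z) \<le> cell_value V p" if "\<sigma> \<in> invariant_measures V" for \<sigma>
    unfolding cell_value_def by (intro cINF_greatest invariant_measure_le that)
  with invariant_measure_exists[of p] show ?thesis
    by (metis antisym)
qed

end

lemma torus_smooth_imp_torus_field:
  fixes V :: "'n::finite torus \<Rightarrow> real ^ 'n"
  assumes "V \<in> torus_smooth"
  shows "\<exists>L M K. torus_field V L M K"
proof -
  let ?F = "periodic_lift V"
  have C2: "k_times_cont_diff (Suc (Suc 0)) ?F"
    using assms by (auto simp: torus_smooth_def torus_Ck_def simp del: k_times_cont_diff.simps)
  obtain A B where AB: "C11 A B ?F"
    using periodic_C2_imp_C11[OF periodic_periodic_lift C2] by blast
  \<comment> \<open>The derivative bound \<open>A\<close> may be 0, while the locale asks for a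
    positive constant.\<close>
  define L where "L = A + 1"
  have C11: "C11 L B ?F"
    by (rule C11_mono[OF AB]) (simp_all add: L_def)
  have "0 < L"
    using AB by (simp add: L_def C11_def)
  obtain F' where F': "\<And>x. (?F has_derivative F' x) (at x)" "\<And>x k. norm (F' x k) \<le> L * norm k"
    using C11_E[OF C11] by metis
  have "continuous_on UNIV ?F"
    by (intro continuous_at_imp_continuous_on ballI has_derivative_continuous[OF F'(1)])
  then obtain M where M: "\<And>x. norm (?F x) \<le> M"
    using periodic_continuous_bounded[OF periodic_periodic_lift] by blast
  have "torus_field V L M B"
    using \<open>0 < L\<close> M C11 bounded_derivative_imp_lipschitz[OF F']
    by unfold_locales auto
  then show ?thesis by blast
qed

theorem lemma3p2:
  fixes V :: "'n::finite torus \<Rightarrow> real ^ 'n" and p :: "real ^ 'n"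
  assumes "V \<in> torus_smooth"
    and "divergence_free V"
    and "mean_zero V"
  shows "(\<exists>\<sigma>\<in>invariant_measures V. cell_value V p = (LINT z|\<sigma>. p \<bullet> V z)) \<and>
         (\<forall>\<sigma>\<in>invariant_measures V. (LINT z|\<sigma>. p \<bullet> V z) \<le> cell_value V p)"
proof -
  obtain L M K where "torus_field V L M K"
    using torus_smooth_imp_torus_field[OF assms(1)] by blast
  then show ?thesis
    by (rule torus_field.cell_value_eq_max)
qed

end
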